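(* Suppose $\mathcal Q$ is vertically unbounded. Then $d=\min(B\setminus B^{unb})=\min(B^{ct})$.
   Context: Let $(K,v)$ be a valued field, $\Gamma$ the divisible hull of $vK$, embedded in a divisible ordered abelian group $\Lambda$. Let $\nu\colon K[x]\to\Lambda\cup\{\infty\}$ be a valuation extending $v$ which is well-specified, i.e. it is not the case that simultaneously $\nu^{-1}(\infty)=0$, the value group of $\nu$ modulo $\Gamma$ is torsion, and the residue field of $\nu$ is algebraic over that of $v$. For $s\ge0$ let $\partial_s$ be the $s$-th Hasse–Schmidt derivative, defined by $f(x+y)=\sum_{s\ge0}(\partial_sf)y^s$. For nonconstant $f$ with $\nu(f)<\infty$ the level is $\epsilon_\nu(f)=\max\{(\nu(f)-\nu(\partial_sf))/s: s\ge1\}$; $\epsilon_\nu(a)=-\infty$ for $a\in K$. A monic $Q\in K[x]$ is a key polynomial for $\nu$ if $\epsilon_\nu(f)<\epsilon_\nu(Q)$ whenever $\deg f<\deg Q$. For monic $Q$, each $f$ has a unique $Q$-expansion $f=\sum_{i\ge0}f_{Q,i}Q^i$ with $\deg f_{Q,i}<\deg Q$; set $\nu_Q(f)=\min_i\nu(f_{Q,i}Q^i)$, $S_Q(f)=\{i:\nu(f_{Q,i}Q^i)=\nu_Q(f)\}$, $\deg_Qf=\max S_Q(f)$. Fix $m\ge1$ such that the set $\Psi_m$ of key polynomials of degree $m$ for $\nu$ is nonempty and has no element of maximal $\nu$-value. Let $\mathcal Q\subseteq\Psi_m$ be well-ordered by $Q<R\iff\nu(Q)<\nu(R)$ and cofinal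 in $\Psi_m$ for $\nu$-values; write $\gamma_Q=\nu(Q)$. As in the paper, all values $\nu_Q(f)$ ($f\ne0$) lie in $\Gamma$. "For all $Q$ large enough" means for all $Q$ in a final segment of $\mathcal Q$; a family indexed by $\mathcal Q$ is ultimately constant if it is constant on a final segment. $f$ is $\mathcal Q$-stable if $\nu_Q(f)=\nu(f)$ for all $Q$ large enough, $\mathcal Q$-unstable otherwise. Assume unstable polynomials exist; limit key polynomials are the monic $\mathcal Q$-unstable polynomials of minimal degree, forming $\mathrm{KP}_\infty(\mathcal Q)$. For each $f$, $\deg_Qf$ is ultimately constant; for $f\in\mathrm{KP}_\infty(\mathcal Q)$ its ultimate value $d$ (independent of $f$) is the defect of $\mathcal Q$. Fix $F\in\mathrm{KP}_\infty(\mathcal Q)$, $D=\lfloor\deg F/m\rfloor$, $F=\sum_{\ell=0}^DF_{Q,\ell}Q^\ell$, $\beta_{Q,\ell}=\nu(F_{Q,\ell})\in\Gamma\cup\{\infty\}$. Let $\delta^L$ be the smallest initial segment of $\Gamma$ containing $\{\nu_Q(F):Q\in\mathcal Q\}$; write $x>\delta^L$ if $x\in(\Gamma\setminus\delta^L)\cup\{\infty\}$. Let $J$ be the set of $\ell\in\{0,\dots,D\}$ with $\beta_{Q,\ell}+\ell\gamma_Q>\delta^L$ for all $Q$ large enough, $B=\{0,\dots,D\}\setminus J$, and $B^{ct}$ the set of $\ell\in B$ for which $(\beta_{Q,\ell})_Q$ is ultimately constant. A cut $\eta=(\eta^L,\eta^R)$ of $\Gamma$ is vertically bounded if for every $x\in\eta^L$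 and rational $q>1$ there is $y\in\eta^L$ with $q(y-x)>z-x$ for all $z\in\eta^L$. Let $\gamma_{\mathcal Q}$ be the cut of $\Gamma$ whose lower set is the smallest initial segment containing $\{\gamma_Q\}$; $\mathcal Q$ is vertically unbounded if $\gamma_{\mathcal Q}$ is not vertically bounded. For $\ell\in\{0,\dots,D\}$, $\mathcal B_\ell$ is the smallest initial segment of $\Gamma$ containing all $\beta\in\Gamma$ such that $\beta+\ell\gamma_Q\in\delta^L$ for some $Q\in\mathcal Q$. $B^{unb}$ is the set of $\ell\in B$ such that for every $\beta\in\mathcal B_\ell$ one has $\beta_{Q,\ell}\ge\beta$ for all $Q$ large enough. *)

theory Defs
  imports "HOL-Computational_Algebra.Polynomial" "HOL-Library.Extended"
begin

text \<open>n-fold sum (natural multiple), usable for the group and its extension by infinities.\<close>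
fun nmul :: "nat \<Rightarrow> 'a::{zero,plus} \<Rightarrow> 'a" where
  "nmul 0 x = 0"
| "nmul (Suc n) x = x + nmul n x"

definition zmul :: "int \<Rightarrow> 'g::ab_group_add \<Rightarrow> 'g" where
  "zmul a x = (if 0 \<le> a then nmul (nat a) x else - nmul (nat (- a)) x)"

text \<open>Division by a positive integer in a divisible (torsion-free) group.\<close>
definition gdiv :: "'g::ab_group_add \<Rightarrow> nat \<Rightarrow> 'g" where
  "gdiv x s = (THE y. nmul s y = x)"

definition qsmul :: "rat \<Rightarrow> 'g::ab_group_add \<Rightarrow> 'g" where
  "qsmul q x = gdiv (zmul (fst (quotient_of q)) x) (nat (snd (quotient_of q)))"

definition divisible_group :: "'g::ab_group_add itself \<Rightarrow> bool" where
  "divisible_group _ \<longleftrightarrow> (\<forall>(x::'g) n. 0 < n \<longrightarrow> (\<exists>y. nmul n y = x))"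

definition poly_valuation :: "('k::field poly \<Rightarrow> 'g::linordered_ab_group_add extended) \<Rightarrow> bool" where
  "poly_valuation \<nu> \<longleftrightarrow>
     \<nu> 0 = Pinf \<and> \<nu> 1 = Fin 0 \<and> (\<forall>f. \<nu> f \<noteq> Minf) \<and>
     (\<forall>f g. \<nu> (f * g) = \<nu> f + \<nu> g) \<and>
     (\<forall>f g. min (\<nu> f) (\<nu> g) \<le> \<nu> (f + g))"

definition vK :: "('k::field poly \<Rightarrow> 'g::linordered_ab_group_add extended) \<Rightarrow> 'g set" where
  "vK \<nu> = {x. \<exists>a. a \<noteq> 0 \<and> \<nu> [:a:] = Fin x}"

definition Gam :: "('k::field poly \<Rightarrow> 'g::linordered_ab_group_add extended) \<Rightarrow> 'g set" where
  "Gam \<nu> = {x. \<exists>n>0. nmul n x \<in> vK \<nu>}"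

text \<open>Residue field of \<nu> (for trivial support, \<nu> extended to K(x)) is algebraic over that of v:
  the residue of every h = f/g with \<nu>(h) \<ge> 0 is a root of a monic polynomial whose coefficients
  are residues of elements c_i of the valuation ring of v, i.e.
  \<nu>(h^n + \<Sum> c_i h^i) > 0, cleared of denominators.\<close>
definition residue_algebraic :: "('k::field poly \<Rightarrow> 'g::linordered_ab_group_add extended) \<Rightarrow> bool" where
  "residue_algebraic \<nu> \<longleftrightarrow>
     (\<forall>f g. g \<noteq> 0 \<and> \<nu> g \<le> \<nu> f \<longrightarrow>
        (\<exists>n>0. \<exists>c::nat \<Rightarrow> 'k. (\<forall>i<n. Fin 0 \<le> \<nu> [:c i:]) \<and>
            nmul n (\<nu> g) < \<nu> (f ^ n + (\<Sum>i<n. [:c i:] * f ^ i * g ^ (n - i)))))"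

definition well_specified :: "('k::field poly \<Rightarrow> 'g::linordered_ab_group_add extended) \<Rightarrow> bool" where
  "well_specified \<nu> \<longleftrightarrow>
     \<not> ((\<forall>f. \<nu> f = Pinf \<longrightarrow> f = 0) \<and>
        (\<forall>f g a b. \<nu> f = Fin a \<and> \<nu> g = Fin b \<longrightarrow> (\<exists>n>0. nmul n (a - b) \<in> Gam \<nu>)) \<and>
        residue_algebraic \<nu>)"

text \<open>f(x+y) = \<Sum>_s (\<partial>_s f) y^s : coefficient of y^s in f(x+y) \<in> K[x][y].\<close>
definition hasse :: "nat \<Rightarrow> 'k::field poly \<Rightarrow> 'k poly" where
  "hasse s f = coeff (pcompose (map_poly (\<lambda>c. [:c:]) f) [: [:0, 1:], 1 :]) s"

text \<open>Level \<epsilon>_\<nu>(f). Constants get -\<infinity>. For nonconstant f with \<nu>(f) finite it is the max of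
  (\<nu>(f) - \<nu>(\<partial>_s f))/s over s \<ge> 1 (terms with \<nu>(\<partial>_s f) = \<infinity>, in particular s > deg f,
  count as -\<infinity>). For nonconstant f with \<nu>(f) = \<infinity> (where the paper leaves \<epsilon> undefined) we put \<infinity>.\<close>
definition level :: "('k::field poly \<Rightarrow> 'g::linordered_ab_group_add extended) \<Rightarrow> 'k poly \<Rightarrow> 'g extended" where
  "level \<nu> f =
     (if degree f = 0 then Minf
      else if \<nu> f = Pinf then Pinf
      else Max ((\<lambda>s. case (\<nu> f, \<nu> (hasse s f)) of
                        (Fin a, Fin b) \<Rightarrow> Fin (gdiv (a - b) s)
                      | _ \<Rightarrow> Minf) ` {1..degree f}))"

text \<open>Key polynomial: monic, and \<epsilon>(f) < \<epsilon>(Q) for all f of smaller degree for which \<epsilon>(f) is defined.\<close>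
definition key_poly :: "('k::field poly \<Rightarrow> 'g::linordered_ab_group_add extended) \<Rightarrow> 'k poly \<Rightarrow> bool" where
  "key_poly \<nu> Q \<longleftrightarrow> lead_coeff Q = 1 \<and>
     (\<forall>f. degree f < degree Q \<and> (degree f = 0 \<or> \<nu> f \<noteq> Pinf) \<longrightarrow> level \<nu> f < level \<nu> Q)"

definition Psi :: "('k::field poly \<Rightarrow> 'g::linordered_ab_group_add extended) \<Rightarrow> nat \<Rightarrow> 'k poly set" where
  "Psi \<nu> m = {Q. key_poly \<nu> Q \<and> degree Q = m}"

definition qcoeff :: "'k::field poly \<Rightarrow> 'k poly \<Rightarrow> nat \<Rightarrow> 'k poly" where
  "qcoeff Q f i = (f div Q ^ i) mod Q"

definition nuQ :: "('k::field poly \<Rightarrow> 'g::linordered_ab_group_add extended) \<Rightarrow> 'k poly \<Rightarrow> 'k poly \<Rightarrow> 'g extended" where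
  "nuQ \<nu> Q f = Min ((\<lambda>i. \<nu> (qcoeff Q f i * Q ^ i)) ` {0..degree f})"

definition SQ :: "('k::field poly \<Rightarrow> 'g::linordered_ab_group_add extended) \<Rightarrow> 'k poly \<Rightarrow> 'k poly \<Rightarrow> nat set" where
  "SQ \<nu> Q f = {i \<in> {0..degree f}. \<nu> (qcoeff Q f i * Q ^ i) = nuQ \<nu> Q f}"

definition degQ :: "('k::field poly \<Rightarrow> 'g::linordered_ab_group_add extended) \<Rightarrow> 'k poly \<Rightarrow> 'k poly \<Rightarrow> nat" where
  "degQ \<nu> Q f = Max (SQ \<nu> Q f)"

text \<open>"For all Q \<in> Qs large enough": on a (nonempty) final segment of the well-ordered Qs.\<close>
definition ev_large :: "'k poly set \<Rightarrow> ('k poly \<Rightarrow> 'g::linorder extended) \<Rightarrow> ('k poly \<Rightarrow> bool) \<Rightarrow> bool" where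
  "ev_large Qs \<nu> P \<longleftrightarrow> (\<exists>Q0\<in>Qs. \<forall>Q\<in>Qs. \<nu> Q0 \<le> \<nu> Q \<longrightarrow> P Q)"

definition Qstable :: "('k::field poly \<Rightarrow> 'g::linordered_ab_group_add extended) \<Rightarrow> 'k poly set \<Rightarrow> 'k poly \<Rightarrow> bool" where
  "Qstable \<nu> Qs f \<longleftrightarrow> ev_large Qs \<nu> (\<lambda>Q. nuQ \<nu> Q f = \<nu> f)"

definition KPinf :: "('k::field poly \<Rightarrow> 'g::linordered_ab_group_add extended) \<Rightarrow> 'k poly set \<Rightarrow> 'k poly set" where
  "KPinf \<nu> Qs = {F. lead_coeff F = 1 \<and> \<not> Qstable \<nu> Qs F \<and>
       (\<forall>g. lead_coeff g = 1 \<and> \<not> Qstable \<nu> Qs g \<longrightarrow> degree F \<le> degree g)}"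

definition vert_bounded :: "'g::linordered_ab_group_add set \<Rightarrow> bool" where
  "vert_bounded L \<longleftrightarrow>
     (\<forall>x\<in>L. \<forall>q::rat. 1 < q \<longrightarrow> (\<exists>y\<in>L. \<forall>z\<in>L. z - x < qsmul q (y - x)))"

definition gammaL :: "('k::field poly \<Rightarrow> 'g::linordered_ab_group_add extended) \<Rightarrow> 'k poly set \<Rightarrow> 'g set" where
  "gammaL \<nu> Qs = {x \<in> Gam \<nu>. \<exists>Q\<in>Qs. Fin x \<le> \<nu> Q}"

definition deltaL :: "('k::field poly \<Rightarrow> 'g::linordered_ab_group_add extended) \<Rightarrow> 'k poly set \<Rightarrow> 'k poly \<Rightarrow> 'g set" where
  "deltaL \<nu> Qs F = {x \<in> Gam \<nu>. \<exists>Q\<in>Qs. Fin x \<le> nuQ \<nu> Q F}"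

definition above_delta :: "('k::field poly \<Rightarrow> 'g::linordered_ab_group_add extended) \<Rightarrow> 'k poly set \<Rightarrow> 'k poly \<Rightarrow> 'g extended \<Rightarrow> bool" where
  "above_delta \<nu> Qs F x \<longleftrightarrow> x = Pinf \<or> (\<exists>y. x = Fin y \<and> y \<in> Gam \<nu> \<and> y \<notin> deltaL \<nu> Qs F)"

definition Dnum :: "'k::field poly \<Rightarrow> nat \<Rightarrow> nat" where
  "Dnum F m = degree F div m"

definition betaQ :: "('k::field poly \<Rightarrow> 'g::linordered_ab_group_add extended) \<Rightarrow> 'k poly \<Rightarrow> 'k poly \<Rightarrow> nat \<Rightarrow> 'g extended" where
  "betaQ \<nu> F Q l = \<nu> (qcoeff Q F l)"

definition Jset :: "('k::field poly \<Rightarrow> 'g::linordered_ab_group_add extended) \<Rightarrow> 'k poly set \<Rightarrow> nat \<Rightarrow> 'k poly \<Rightarrow> nat set" where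
  "Jset \<nu> Qs m F = {l \<in> {0..Dnum F m}.
      ev_large Qs \<nu> (\<lambda>Q. above_delta \<nu> Qs F (betaQ \<nu> F Q l + nmul l (\<nu> Q)))}"

definition Bset :: "('k::field poly \<Rightarrow> 'g::linordered_ab_group_add extended) \<Rightarrow> 'k poly set \<Rightarrow> nat \<Rightarrow> 'k poly \<Rightarrow> nat set" where
  "Bset \<nu> Qs m F = {0..Dnum F m} - Jset \<nu> Qs m F"

definition Bct :: "('k::field poly \<Rightarrow> 'g::linordered_ab_group_add extended) \<Rightarrow> 'k poly set \<Rightarrow> nat \<Rightarrow> 'k poly \<Rightarrow> nat set" where
  "Bct \<nu> Qs m F = {l \<in> Bset \<nu> Qs m F. \<exists>c. ev_large Qs \<nu> (\<lambda>Q. betaQ \<nu> F Q l = c)}"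

definition calB :: "('k::field poly \<Rightarrow> 'g::linordered_ab_group_add extended) \<Rightarrow> 'k poly set \<Rightarrow> 'k poly \<Rightarrow> nat \<Rightarrow> 'g set" where
  "calB \<nu> Qs F l = {x \<in> Gam \<nu>. \<exists>b \<in> Gam \<nu>. \<exists>Q\<in>Qs.
       x \<le> b \<and> Fin b + nmul l (\<nu> Q) \<in> Fin ` deltaL \<nu> Qs F}"

definition Bunb :: "('k::field poly \<Rightarrow> 'g::linordered_ab_group_add extended) \<Rightarrow> 'k poly set \<Rightarrow> nat \<Rightarrow> 'k poly \<Rightarrow> nat set" where
  "Bunb \<nu> Qs m F = {l \<in> Bset \<nu> Qs m F.
      \<forall>b \<in> calB \<nu> Qs F l. ev_large Qs \<nu> (\<lambda>Q. Fin b \<le> betaQ \<nu> F Q l)}"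

end

theory Submission
  imports Defs
begin

text \<open>
  Write \<open>\<gamma>\<close> for the value of \<open>Q\<close>. For large \<open>Q\<close> the coefficient of index \<open>d\<close> of \<open>F\<close> has a
  constant value \<open>\<beta>\<close>, so the truncated value of \<open>F\<close> is \<open>\<beta> + d\<gamma>\<close>, and the coefficient of index
  \<open>l\<close> has value at least \<open>\<beta> + (d - l)\<gamma>\<close>. Vertical unboundedness says that, for a suitable
  \<open>x\<close>, the differences \<open>\<gamma> - x\<close> are cofinal in a convex subgroup. Hence for \<open>l < d\<close> these
  lower bounds exceed any constant value that \<open>B\<close> would allow, and \<open>l\<close> is not in \<open>B\<^sup>c\<^sup>t\<close>. They also
  exhaust the initial segment \<open>\<B>\<^sub>l\<close>, so \<open>l \<in> B\<close> implies \<open>l \<in> B\<^sup>u\<^sup>n\<^sup>b\<close>, unless \<open>\<B>\<^sub>l\<close> is enlarged by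
  an early \<open>Q\<close> whose value lies below \<open>x\<close> by more than that convex subgroup. In this exceptional
  case carries in products modulo \<open>Q\<close> are negligible, every coefficient of index \<open>l \<ge> 1\<close> that
  is not negligible has ultimately constant value, and \<open>B\<close> has no element strictly between
  \<open>0\<close> and \<open>d\<close>.
\<close>

section \<open>Multiples in ordered groups, Hasse derivatives and expansions\<close>

lemma nmul_zero [simp]: "nmul n (0::'a::comm_monoid_add) = 0"
  by (induction n) auto

lemma nmul_add_right: "nmul n (x + y) = nmul n x + nmul n (y::'a::comm_monoid_add)"
  by (induction n) (auto simp: ac_simps)

lemma nmul_add_left: "nmul (m + n) x = nmul m x + nmul n (x::'a::comm_monoid_add)"
  by (induction m) (auto simp: ac_simps)

lemma nmul_mult: "nmul (m * n) x = nmul m (nmul n (x::'a::comm_monoid_add))"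
  by (induction m) (auto simp: nmul_add_left)

lemma nmul_minus: "nmul n (- x) = - nmul n (x::'a::ab_group_add)"
  by (induction n) auto

lemma nmul_diff_right: "nmul n (x - y) = nmul n x - nmul n (y::'a::ab_group_add)"
  using nmul_add_right[of n x "- y"] by (simp add: nmul_minus)

lemma nmul_diff_left: "j \<le> i \<Longrightarrow> nmul (i - j) x = nmul i x - nmul j (x::'a::ab_group_add)"
  using nmul_add_left[of "i - j" j x] by simp

lemma nmul_nonneg: "0 \<le> (x::'a::linordered_ab_group_add) \<Longrightarrow> 0 \<le> nmul n x"
  by (induction n) auto

lemma nmul_mono: "(x::'a::linordered_ab_group_add) \<le> y \<Longrightarrow> nmul n x \<le> nmul n y"
  by (induction n) (auto intro: add_mono)

lemma nmul_strict_mono: "(x::'a::linordered_ab_group_add) < y \<Longrightarrow> 0 < n \<Longrightarrow> nmul n x < nmul n y"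
proof (induction n)
  case (Suc n)
  then show ?case using nmul_mono[of x y n] by (auto intro: add_less_le_mono)
qed simp

lemma nmul_le_iff: "0 < n \<Longrightarrow> nmul n x \<le> nmul n y \<longleftrightarrow> (x::'a::linordered_ab_group_add) \<le> y"
  using nmul_mono[of x y n] nmul_strict_mono[of y x n] by force

lemma nmul_cancel: "0 < n \<Longrightarrow> nmul n x = nmul n y \<longleftrightarrow> (x::'a::linordered_ab_group_add) = y"
  by (metis nmul_le_iff order.eq_iff)

lemma nmul_mono_left:
  assumes "m \<le> n" "0 \<le> (x::'a::linordered_ab_group_add)"
  shows "nmul m x \<le> nmul n x"
  using assms nmul_add_left[of m "n - m" x] nmul_nonneg[of x "n - m"] by simp

lemma nmul_Fin: "nmul n (Fin x) = Fin (nmul n (x::'a::comm_monoid_add))"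
  by (induction n) (auto simp: zero_extended_def)

text \<open>Divisibility supplies the quotient, and the order makes multiplication by
  \<open>n\<close> injective, so the definite description in \<open>gdiv\<close> is proper.\<close>

lemma nmul_gdiv:
  fixes x :: "'g::linordered_ab_group_add"
  assumes "divisible_group TYPE('g)" "0 < n"
  shows "nmul n (gdiv x n) = x"
proof -
  obtain y where y: "nmul n y = x" using assms unfolding divisible_group_def by blast
  then have "gdiv x n = y"
    unfolding gdiv_def using nmul_cancel[OF assms(2)] by (intro the_equality) auto
  then show ?thesis using y by simp
qed

section \<open>Additivity and Leibniz rule for Hasse derivatives\<close>

lemma map_poly_const_add:
  "map_poly (\<lambda>c. [:c:]) (f + g) = map_poly (\<lambda>c. [:c:]) f + map_poly (\<lambda>c. [:c:]) (g::'k::field poly)"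
  by (rule poly_eqI) (simp add: coeff_map_poly)

lemma const_poly_sum: "[:sum f A:] = (\<Sum>i\<in>A. [:f i:])"
  by (rule poly_eqI) (simp add: coeff_sum coeff_pCons split: nat.split)

lemma map_poly_const_mult:
  "map_poly (\<lambda>c. [:c:]) (f * g) = map_poly (\<lambda>c. [:c:]) f * map_poly (\<lambda>c. [:c:]) (g::'k::field poly)"
  by (rule poly_eqI) (auto simp: coeff_map_poly coeff_mult const_poly_sum intro!: sum.cong)

lemma hasse_add: "hasse s (f + g) = hasse s f + hasse s g"
  by (simp add: hasse_def map_poly_const_add pcompose_add)

lemma hasse_mult: "hasse s (f * g) = (\<Sum>i\<le>s. hasse i f * hasse (s - i) g)"
  by (simp add: hasse_def map_poly_const_mult pcompose_mult coeff_mult)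

lemma hasse_0_left: "hasse 0 f = f"
proof -
  have "coeff (pcompose (map_poly (\<lambda>c. [:c:]) f) [: [:0, 1:], 1 :]) 0 = f"
  proof (induction f)
    case (pCons a f)
    then show ?case by (simp add: map_poly_pCons pcompose_pCons coeff_mult)
  qed simp
  then show ?thesis by (simp add: hasse_def)
qed

lemma hasse_eq_0: "degree f < s \<Longrightarrow> hasse s f = 0"
proof -
  assume s: "degree f < s"
  have "degree (pcompose (map_poly (\<lambda>c. [:c:]) f) [: [:0, 1:], 1 :]) \<le> degree f"
    using degree_pcompose_le[of "map_poly (\<lambda>c. [:c:]) f" "[: [:0, 1:], 1 :]"]
      map_poly_degree_leq[of "\<lambda>c. [:c:]" f] by simp
  then show ?thesis using s by (simp add: hasse_def coeff_eq_0)
qed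

section \<open>Expansions in powers of a polynomial\<close>

lemma div_poly_sum: "(\<Sum>i\<in>A. f i) div (p::'k::field poly) = (\<Sum>i\<in>A. f i div p)"
  by (induction A rule: infinite_finite_induct) (simp_all add: poly_div_add_left)

lemma mod_poly_sum: "(\<Sum>i\<in>A. f i) mod (p::'k::field poly) = (\<Sum>i\<in>A. f i mod p)"
  by (induction A rule: infinite_finite_induct) (simp_all add: poly_mod_add_left)

lemma qcoeff_add: "qcoeff Q (f + g) i = qcoeff Q f i + qcoeff Q g i"
  by (simp add: qcoeff_def poly_div_add_left poly_mod_add_left)

lemma qcoeff_sum: "qcoeff Q (\<Sum>j\<in>A. f j) i = (\<Sum>j\<in>A. qcoeff Q (f j) i)"
  by (simp add: qcoeff_def div_poly_sum mod_poly_sum)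

lemma qcoeff_0: "qcoeff Q 0 i = 0"
  by (simp add: qcoeff_def)

lemma qcoeff_0_right [simp]: "qcoeff Q f 0 = f mod Q"
  by (simp add: qcoeff_def)

lemma degree_qcoeff: "1 \<le> degree Q \<Longrightarrow> degree (qcoeff Q f i) < degree Q"
  unfolding qcoeff_def using degree_mod_less[of Q "f div Q ^ i"] by fastforce

lemma qcoeff_eq_0:
  assumes "degree f < i * degree Q"
  shows "qcoeff Q f i = 0"
proof -
  have "degree (Q ^ i) = i * degree Q"
    using assms by (cases "Q = 0") (auto simp: degree_power_eq)
  then show ?thesis using assms by (simp add: qcoeff_def div_poly_less)
qed

lemma qcoeff_mult_power:
  assumes "1 \<le> degree Q"
  shows "qcoeff Q (f * Q ^ k) i = (if i < k then 0 else qcoeff Q f (i - k))"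
proof (cases "i < k")
  case True
  have Q: "Q ^ i \<noteq> 0" using assms by auto
  define j where "j = k - 1 - i"
  have k: "k = j + 1 + i" using True by (simp add: j_def)
  have "f * Q ^ k = (f * Q ^ j * Q) * Q ^ i"
    unfolding k power_add power_one_right by (simp only: mult.assoc)
  then have "f * Q ^ k div Q ^ i = f * Q ^ j * Q"
    using nonzero_mult_div_cancel_right[OF Q, of "f * Q ^ j * Q"] by argo
  then show ?thesis using True by (simp add: qcoeff_def)
next
  case False
  have Q: "Q ^ k \<noteq> 0" using assms by auto
  define j where "j = i - k"
  have i: "i = k + j" using False by (simp add: j_def)
  have "f * Q ^ k div Q ^ i = f div Q ^ j"
    unfolding i power_add poly_div_mult_right using nonzero_mult_div_cancel_right[OF Q, of f] by argo
  then show ?thesis using i by (simp add: qcoeff_def)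
qed

lemma qcoeff_small:
  assumes "degree f < degree Q"
  shows "qcoeff Q f i = (if i = 0 then f else 0)"
  using assms qcoeff_eq_0[of f i Q]
  by (cases i) (auto simp: mod_poly_less)

text \<open>Each induction step divides the part not yet expanded by \<open>Q\<close> once more;
  \<open>qexpansion\<close> follows once that part vanishes for degree reasons.\<close>

lemma qexpansion_partial:
  "(\<Sum>i<n. qcoeff Q f i * Q ^ i) + (f div Q ^ n) * Q ^ n = f"
proof (induction n)
  case (Suc n)
  have "f div Q ^ n = (f div Q ^ Suc n) * Q + qcoeff Q f n"
    by (simp add: qcoeff_def power_Suc2 poly_div_mult_right del: power_Suc)
  then have "(f div Q ^ n) * Q ^ n = (f div Q ^ Suc n) * Q ^ Suc n + qcoeff Q f n * Q ^ n"
    by (metis (no_types, lifting) distrib_right mult.assoc power_Suc)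
  then show ?case using Suc.IH by (simp add: add.commute add.left_commute del: power_Suc)
qed simp

lemma qexpansion:
  assumes "1 \<le> degree Q"
  shows "f = (\<Sum>i\<le>degree f. qcoeff Q f i * Q ^ i)"
proof -
  have "degree f < Suc (degree f) * degree Q" using assms by (cases "degree Q") auto
  moreover have "degree (Q ^ Suc (degree f)) = Suc (degree f) * degree Q"
    using assms by (subst degree_power_eq) auto
  ultimately have "f div Q ^ Suc (degree f) = 0" by (intro div_poly_less) simp
  then show ?thesis
    using qexpansion_partial[of Q f "Suc (degree f)"] by (simp add: lessThan_Suc_atMost)
qed

section \<open>Elementary rules for values of polynomials\<close>

locale poly_val =
  fixes \<nu> :: "'k::field poly \<Rightarrow> 'g::linordered_ab_group_add extended"
  assumes val: "poly_valuation \<nu>"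
begin

lemma nu_0 [simp]: "\<nu> 0 = Pinf"
  and nu_1: "\<nu> 1 = Fin 0"
  and nu_Minf: "\<nu> f \<noteq> Minf"
  and nu_mult: "\<nu> (f * g) = \<nu> f + \<nu> g"
  and nu_min: "min (\<nu> f) (\<nu> g) \<le> \<nu> (f + g)"
  using val by (auto simp: poly_valuation_def)

lemma nu_add_ge: "t \<le> \<nu> f \<Longrightarrow> t \<le> \<nu> g \<Longrightarrow> t \<le> \<nu> (f + g)"
  using nu_min[of f g] by (meson min.boundedI order.trans)

lemma nu_add_gt: "t < \<nu> f \<Longrightarrow> t < \<nu> g \<Longrightarrow> t < \<nu> (f + g)"
  using nu_min[of f g] by (metis min_less_iff_conj order_less_le_trans)

lemma nu_minus [simp]: "\<nu> (- f) = \<nu> f"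
proof -
  have 1: "\<nu> (-1) + \<nu> (-1) = Fin 0" using nu_mult[of "-1" "-1"] nu_1 by simp
  have "\<nu> (-1) = Fin 0"
  proof (cases "\<nu> (-1)")
    case (Fin x)
    then have "x + x = 0" using 1 by simp
    then show ?thesis using Fin by simp
  qed (use 1 in auto)
  then show ?thesis using nu_mult[of "-1" f] by (cases "\<nu> f") auto
qed

lemma nu_diff_ge: "t \<le> \<nu> f \<Longrightarrow> t \<le> \<nu> g \<Longrightarrow> t \<le> \<nu> (f - g)"
  using nu_add_ge[of t f "- g"] by simp

lemma nu_diff_gt: "t < \<nu> f \<Longrightarrow> t < \<nu> g \<Longrightarrow> t < \<nu> (f - g)"
  using nu_add_gt[of t f "- g"] by simp

lemma nu_sum_ge: "(\<And>i. i \<in> A \<Longrightarrow> t \<le> \<nu> (f i)) \<Longrightarrow> t \<le> \<nu> (\<Sum>i\<in>A. f i)"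
  by (induction A rule: infinite_finite_induct) (auto intro: nu_add_ge)

lemma nu_sum_gt: "(\<And>i. i \<in> A \<Longrightarrow> Fin t < \<nu> (f i)) \<Longrightarrow> Fin t < \<nu> (\<Sum>i\<in>A. f i)"
  by (induction A rule: infinite_finite_induct) (auto intro: nu_add_gt)

lemma nu_add_eq: "\<nu> f < \<nu> g \<Longrightarrow> \<nu> (f + g) = \<nu> f"
proof -
  assume a: "\<nu> f < \<nu> g"
  then have "\<nu> f \<le> \<nu> (f + g)" by (intro nu_add_ge) auto
  moreover have "\<not> \<nu> f < \<nu> (f + g)" using nu_diff_gt[of "\<nu> f" "f + g" g] a by auto
  ultimately show ?thesis by auto
qed

lemma nu_power: "\<nu> (f ^ n) = nmul n (\<nu> f)"
  by (induction n) (auto simp: nu_1 nu_mult zero_extended_def)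

end

section \<open>Products modulo a key polynomial\<close>

definition level_term :: "('k::field poly \<Rightarrow> 'g::linordered_ab_group_add extended) \<Rightarrow> 'k poly \<Rightarrow> nat \<Rightarrow> 'g extended" where
  "level_term \<nu> f s = (case (\<nu> f, \<nu> (hasse s f)) of
     (Fin a, Fin b) \<Rightarrow> Fin (gdiv (a - b) s) | _ \<Rightarrow> Minf)"

lemma level_altdef:
  "level \<nu> f = (if degree f = 0 then Minf else if \<nu> f = Pinf then Pinf
     else Max (level_term \<nu> f ` {1..degree f}))"
  by (simp add: level_def level_term_def[abs_def])

text \<open>Makes a monic nonconstant polynomial of infinite value a key polynomial: its level
  \<open>Pinf\<close> exceeds every level it is compared with.\<close>

lemma level_less_Pinf:
  assumes "degree f = 0 \<or> \<nu> f \<noteq> Pinf"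
  shows "level \<nu> f < Pinf"
proof (cases "degree f = 0")
  case False
  then have "Max (level_term \<nu> f ` {1..degree f}) < Pinf"
    by (subst Max_less_iff) (auto simp: level_term_def split: extended.splits)
  then show ?thesis using False assms by (simp add: level_altdef)
qed (simp add: level_altdef)

locale key_val = poly_val \<nu>
  for \<nu> :: "'k::field poly \<Rightarrow> 'g::linordered_ab_group_add extended" +
  fixes m :: nat
  assumes divisible: "divisible_group TYPE('g)"
    and m_pos: "1 \<le> m"
    and Psi_nomax: "\<not> (\<exists>P\<in>Psi \<nu> m. \<forall>P'\<in>Psi \<nu> m. \<nu> P' \<le> \<nu> P)"
begin

text \<open>A nonzero \<open>f\<close> of infinite value and degree at most \<open>m\<close> would have a monic multiple of
  degree \<open>m\<close>, a key polynomial of maximal value \<open>\<infinity>\<close>.\<close>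

lemma finite_value:
  assumes "f \<noteq> 0" "degree f \<le> m"
  obtains x where "\<nu> f = Fin x"
proof -
  have "\<nu> f \<noteq> Pinf"
  proof
    assume inf: "\<nu> f = Pinf"
    define P where "P = f * smult (1 / lead_coeff f) (monom 1 (m - degree f))"
    have deg: "degree P = m" unfolding P_def using assms
      by (subst degree_mult_eq) (auto simp: degree_monom_eq monom_eq_0_iff)
    have monic: "lead_coeff P = 1" unfolding P_def using assms
      by (subst lead_coeff_mult) (auto simp: degree_monom_eq)
    have nuP: "\<nu> P = Pinf"
      unfolding P_def nu_mult inf
      by (cases "\<nu> (smult (1 / lead_coeff f) (monom 1 (m - degree f)))") auto
    have "level \<nu> P = Pinf" using nuP deg m_pos by (simp add: level_altdef)
    then have "P \<in> Psi \<nu> m"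
      using monic deg level_less_Pinf by (auto simp: Psi_def key_poly_def)
    then show False using Psi_nomax nuP by auto
  qed
  then show ?thesis using that nu_Minf[of f] by (cases "\<nu> f") auto
qed

lemma Psi_degree: "Q \<in> Psi \<nu> m \<Longrightarrow> degree Q = m"
  and Psi_monic: "Q \<in> Psi \<nu> m \<Longrightarrow> lead_coeff Q = 1"
  by (auto simp: Psi_def key_poly_def)

lemma Psi_nonzero: "Q \<in> Psi \<nu> m \<Longrightarrow> Q \<noteq> 0"
  using Psi_monic by fastforce

text \<open>A division-free form of the key polynomial property: \<epsilon> is the level of
  \<open>Q\<close>, \<open>b\<close> is an order at which the maximum defining it is attained, and
  the quotients by \<open>s\<close> are cleared by multiplying with \<open>s\<close>.\<close>

lemma key_levelE:
  assumes Q: "Q \<in> Psi \<nu> m"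
  obtains \<gamma> \<epsilon> b where "\<nu> Q = Fin \<gamma>" "1 \<le> b" "\<nu> (hasse b Q) = Fin (\<gamma> - nmul b \<epsilon>)"
    "\<And>s. Fin (\<gamma> - nmul s \<epsilon>) \<le> \<nu> (hasse s Q)"
    "\<And>f \<phi> s. degree f < m \<Longrightarrow> \<nu> f = Fin \<phi> \<Longrightarrow> 1 \<le> s \<Longrightarrow> Fin (\<phi> - nmul s \<epsilon>) < \<nu> (hasse s f)"
proof -
  obtain \<gamma> where \<gamma>: "\<nu> Q = Fin \<gamma>"
    using finite_value[of Q] Psi_nonzero[OF Q] Psi_degree[OF Q] by auto
  have deg: "degree Q = m" by (rule Psi_degree[OF Q])
  have key: "level \<nu> f < level \<nu> Q" if "degree f < m" "degree f = 0 \<or> \<nu> f \<noteq> Pinf" for f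
    using Q that deg by (auto simp: Psi_def key_poly_def)
  have lev: "level \<nu> Q = Max (level_term \<nu> Q ` {1..m})"
    using deg m_pos \<gamma> by (simp add: level_altdef)
  have "level \<nu> Q \<in> level_term \<nu> Q ` {1..m}"
    unfolding lev using m_pos by (intro Max_in) auto
  then obtain b where b: "1 \<le> b" "level \<nu> Q = level_term \<nu> Q b" by auto
  \<comment> \<open>Constants have level \<open>Minf\<close>, so the strict comparison with a
    constant excludes this value for \<open>Q\<close>.\<close>
  have "level \<nu> Q \<noteq> Minf" using key[of 0] m_pos by auto
  then obtain y where y: "\<nu> (hasse b Q) = Fin y"
    using b by (auto simp: level_term_def split: extended.splits)
  define \<epsilon> where "\<epsilon> = gdiv (\<gamma> - y) b"
  have eps: "level \<nu> Q = Fin \<epsilon>" using b y \<gamma> by (simp add: level_term_def \<epsilon>_def)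
  have 1: "nmul b \<epsilon> = \<gamma> - y" unfolding \<epsilon>_def by (rule nmul_gdiv[OF divisible]) (use b in simp)
  have mul: "nmul s (gdiv z s) = z" if "1 \<le> s" for s and z :: 'g
    using nmul_gdiv[OF divisible] that by simp
  have 2: "Fin (\<gamma> - nmul s \<epsilon>) \<le> \<nu> (hasse s Q)" for s
  proof (cases "s = 0 \<or> m < s")
    case True
    then show ?thesis using \<gamma> deg by (auto simp: hasse_0_left hasse_eq_0)
  next
    case False
    then have le: "level_term \<nu> Q s \<le> Fin \<epsilon>" unfolding eps[symmetric] lev by (intro Max_ge) auto
    show ?thesis
    proof (cases "\<nu> (hasse s Q)")
      case (Fin z)
      then have "gdiv (\<gamma> - z) s \<le> \<epsilon>" using le \<gamma> by (simp add: level_term_def)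
      then have "\<gamma> - z \<le> nmul s \<epsilon>" using nmul_mono[of "gdiv (\<gamma> - z) s" \<epsilon> s] mul[of s] False by simp
      then show ?thesis using Fin by (simp add: algebra_simps)
    qed (use nu_Minf in auto)
  qed
  have 3: "Fin (\<phi> - nmul s \<epsilon>) < \<nu> (hasse s f)"
    if f: "degree f < m" "\<nu> f = Fin \<phi>" "1 \<le> s" for f \<phi> s
  proof (cases "degree f < s")
    case False
    then have df: "degree f \<noteq> 0" using f by auto
    have "level_term \<nu> f s \<le> level \<nu> f"
      using df f False by (auto simp: level_altdef intro!: Max_ge)
    also have "\<dots> < Fin \<epsilon>" using key[of f] f eps by simp
    finally have le: "level_term \<nu> f s < Fin \<epsilon>" .
    show ?thesis
    proof (cases "\<nu> (hasse s f)")
      case (Fin z)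
      then have "gdiv (\<phi> - z) s < \<epsilon>" using le f by (simp add: level_term_def)
      then have "\<phi> - z < nmul s \<epsilon>"
        using nmul_strict_mono[of "gdiv (\<phi> - z) s" \<epsilon> s] mul[of s] f by simp
      then show ?thesis using Fin by (simp add: algebra_simps)
    qed (use nu_Minf in auto)
  qed (simp add: hasse_eq_0)
  show ?thesis
    by (rule that[of \<gamma> b \<epsilon>]) (use \<gamma> b y 1 2 3 in auto)
qed

text \<open>The product has degree below \<open>2 * m\<close>, so the quotient is again reduced: a
  product of two expansion coefficients carries only once.\<close>

lemma div_small:
  fixes f g Q :: "'k poly"
  assumes "degree Q = m" "degree f < m" "degree g < m"
  shows "degree ((f * g) div Q) < m"
proof (cases "(f * g) div Q = 0")
  case False
  have Q: "Q \<noteq> 0" using assms m_pos by auto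
  have "((f * g) div Q) * Q = f * g - (f * g) mod Q" by (simp add: minus_mod_eq_div_mult)
  moreover have "degree (f * g) < m + m" using degree_mult_le[of f g] assms by simp
  moreover have "degree ((f * g) mod Q) < m + m"
    using degree_mod_less[OF Q, of "f * g"] assms m_pos by auto
  ultimately have "degree (((f * g) div Q) * Q) < m + m" by (simp add: degree_diff_less)
  then show ?thesis using False Q assms by (simp add: degree_mult_eq)
qed (use m_pos in simp)

lemma mod_small: "degree Q = m \<Longrightarrow> degree (f mod Q) < m"
  using degree_mod_less[of Q f] m_pos by (cases "Q = 0") auto

lemma nu_mult_ge: "Fin s \<le> \<nu> f \<Longrightarrow> Fin t \<le> \<nu> g \<Longrightarrow> Fin (s + t) \<le> \<nu> (f * g)"
  unfolding nu_mult by (cases "\<nu> f"; cases "\<nu> g") (auto intro: add_mono)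

lemma nu_mult_gt1: "Fin s < \<nu> f \<Longrightarrow> Fin t \<le> \<nu> g \<Longrightarrow> Fin (s + t) < \<nu> (f * g)"
  unfolding nu_mult by (cases "\<nu> f"; cases "\<nu> g") (auto intro: add_less_le_mono)

lemma nu_mult_gt2: "Fin s \<le> \<nu> f \<Longrightarrow> Fin t < \<nu> g \<Longrightarrow> Fin (s + t) < \<nu> (f * g)"
  using nu_mult_gt1[of t g s f] by (simp add: ac_simps)

text \<open>If \<open>\<nu> (a * Q) \<le> \<nu> (f * g)\<close>, where \<open>a\<close> is the quotient, then the Hasse derivative of an order
  \<open>b\<close> at which \<open>Q\<close> attains its level drops the value of \<open>a * Q = f * g - r\<close> by \<open>b\<close> times
  the level of \<open>Q\<close>, whereas \<open>f\<close>, \<open>g\<close> and the remainder \<open>r\<close> have smaller level.\<close>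

lemma key_div_gt:
  assumes Q: "Q \<in> Psi \<nu> m" and \<gamma>: "\<nu> Q = Fin \<gamma>"
    and fg: "degree f < m" "degree g < m" "\<nu> (f * g) = Fin t"
  shows "Fin (t - \<gamma>) < \<nu> ((f * g) div Q)"
proof (rule ccontr)
  define a where "a = (f * g) div Q"
  define r where "r = (f * g) mod Q"
  have deg: "degree Q = m" by (rule Psi_degree[OF Q])
  have da: "degree a < m" unfolding a_def by (rule div_small[OF deg fg(1,2)])
  have dr: "degree r < m" unfolding r_def by (rule mod_small[OF deg])
  have eq: "f * g = a * Q + r" by (simp add: a_def r_def)
  assume "\<not> Fin (t - \<gamma>) < \<nu> ((f * g) div Q)"
  then have le: "\<nu> a \<le> Fin (t - \<gamma>)" by (simp add: a_def)
  then obtain \<alpha> where \<alpha>: "\<nu> a = Fin \<alpha>" using nu_Minf[of a] by (cases "\<nu> a") auto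
  have le': "\<alpha> + \<gamma> \<le> t" using le \<alpha> by (simp add: algebra_simps)
  obtain \<phi> \<psi> where phi: "\<nu> f = Fin \<phi>" and psi: "\<nu> g = Fin \<psi>" and t: "t = \<phi> + \<psi>"
    using fg(3) nu_Minf[of f] nu_Minf[of g] unfolding nu_mult
    by (cases "\<nu> f"; cases "\<nu> g") auto
  obtain \<gamma>' \<epsilon> b where g': "\<nu> Q = Fin \<gamma>'" and b: "1 \<le> b" "\<nu> (hasse b Q) = Fin (\<gamma>' - nmul b \<epsilon>)"
    and Qs: "\<And>s. Fin (\<gamma>' - nmul s \<epsilon>) \<le> \<nu> (hasse s Q)"
    and small: "\<And>f \<phi> s. degree f < m \<Longrightarrow> \<nu> f = Fin \<phi> \<Longrightarrow> 1 \<le> s \<Longrightarrow> Fin (\<phi> - nmul s \<epsilon>) < \<nu> (hasse s f)"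
    using key_levelE[OF Q] by metis
  have [simp]: "\<gamma>' = \<gamma>" using g' \<gamma> by simp
  have small': "Fin (\<phi> - nmul s \<epsilon>) \<le> \<nu> (hasse s f)" if "degree f < m" "\<nu> f = Fin \<phi>" for f \<phi> s
    using small[OF that, of s] that by (cases s) (auto simp: hasse_0_left)
  have split: "nmul b \<epsilon> = nmul i \<epsilon> + nmul (b - i) \<epsilon>" if "i \<le> b" for i
    using that nmul_add_left[of i "b - i" \<epsilon>] by simp
  have 1: "Fin (t - nmul b \<epsilon>) < \<nu> (hasse b (f * g))"
    unfolding hasse_mult
  proof (rule nu_sum_gt)
    fix i assume i: "i \<in> {..b}"
    have eq: "t - nmul b \<epsilon> = (\<phi> - nmul i \<epsilon>) + (\<psi> - nmul (b - i) \<epsilon>)"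
      using split[of i] i t by simp
    show "Fin (t - nmul b \<epsilon>) < \<nu> (hasse i f * hasse (b - i) g)"
    proof (cases "1 \<le> i")
      case True
      show ?thesis unfolding eq
        by (rule nu_mult_gt1[OF small[OF fg(1) phi True] small'[OF fg(2) psi]])
    next
      case False
      then have "1 \<le> b - i" using b(1) by simp
      show ?thesis unfolding eq
        by (rule nu_mult_gt2[OF small'[OF fg(1) phi] small[OF fg(2) psi \<open>1 \<le> b - i\<close>]])
    qed
  qed
  have "Fin (\<alpha> + \<gamma>) \<le> \<nu> (f * g - a * Q)"
    using le' fg(3) \<alpha> \<gamma> by (intro nu_diff_ge) (auto simp: nu_mult)
  then have r: "Fin (\<alpha> + \<gamma>) \<le> \<nu> r" using eq by simp
  have 2: "Fin (\<alpha> + \<gamma> - nmul b \<epsilon>) < \<nu> (hasse b r)"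
  proof (cases "\<nu> r")
    case (Fin \<rho>)
    then have "Fin (\<alpha> + \<gamma> - nmul b \<epsilon>) \<le> Fin (\<rho> - nmul b \<epsilon>)" using r by simp
    also have "\<dots> < \<nu> (hasse b r)" by (rule small[OF dr Fin b(1)])
    finally show ?thesis .
  next
    case Pinf
    then have "r = 0" using finite_value[of r] dr by force
    then show ?thesis using b(1) by (simp add: hasse_eq_0)
  qed (use nu_Minf in auto)
  have 3: "Fin (\<alpha> + \<gamma> - nmul b \<epsilon>) < \<nu> (\<Sum>i\<in>{1..b}. hasse i a * hasse (b - i) Q)"
  proof (rule nu_sum_gt)
    fix i assume i: "i \<in> {1..b}"
    have eq: "\<alpha> + \<gamma> - nmul b \<epsilon> = (\<alpha> - nmul i \<epsilon>) + (\<gamma>' - nmul (b - i) \<epsilon>)"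
      using split[of i] i t by simp
    show "Fin (\<alpha> + \<gamma> - nmul b \<epsilon>) < \<nu> (hasse i a * hasse (b - i) Q)"
      unfolding eq using i by (intro nu_mult_gt1 small[OF da \<alpha>] Qs) auto
  qed
  have "Fin (\<alpha> + \<gamma> - nmul b \<epsilon>) \<le> Fin (t - nmul b \<epsilon>)" using le' by simp
  then have "Fin (\<alpha> + \<gamma> - nmul b \<epsilon>) < \<nu> (hasse b (f * g) - hasse b r)"
    using order.strict_trans1[OF _ 1] 2 by (intro nu_diff_gt) auto
  moreover have "hasse b (f * g) - hasse b r = hasse b (a * Q)"
    unfolding eq hasse_add by simp
  \<comment> \<open>Among the Leibniz terms only the one with the whole order \<open>b\<close> on
    \<open>Q\<close> attains the critical value; all others exceed it by step
    \<open>3\<close>.\<close>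
  moreover have "hasse b (a * Q) = a * hasse b Q + (\<Sum>i\<in>{1..b}. hasse i a * hasse (b - i) Q)"
    unfolding hasse_mult atMost_atLeast0
    by (subst sum.atLeast_Suc_atMost) (simp_all add: hasse_0_left)
  ultimately have "Fin (\<alpha> + \<gamma> - nmul b \<epsilon>) < \<nu> (a * hasse b Q)"
    using nu_diff_gt[OF _ 3, of "hasse b (a * Q)"] by simp
  then show False using \<alpha> b(2) by (simp add: nu_mult)
qed

text \<open>By \<open>key_div_gt\<close> the multiple of \<open>Q\<close> removed from the product
  has strictly larger value.\<close>

lemma key_mod_ge:
  assumes Q: "Q \<in> Psi \<nu> m" and \<gamma>: "\<nu> Q = Fin \<gamma>"
    and fg: "degree f < m" "degree g < m" "\<nu> (f * g) = Fin t"
  shows "\<nu> ((f * g) mod Q) = Fin t"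
proof -
  have "Fin t < \<nu> (((f * g) div Q) * Q)"
    using nu_mult_gt1[OF key_div_gt[OF Q \<gamma> fg], of \<gamma> Q] \<gamma> by simp
  then have "\<nu> (f * g + - (((f * g) div Q) * Q)) = \<nu> (f * g)"
    using fg(3) by (intro nu_add_eq) simp
  then show ?thesis using fg(3) by (simp add: minus_div_mult_eq_mod)
qed

text \<open>The weight \<gamma> need not be the value of \<open>Q\<close>: below it is the value of
  an earlier key polynomial. Quantifying over lower bounds \<open>t\<close> also covers zero
  products.\<close>

definition compat :: "'k poly \<Rightarrow> 'g \<Rightarrow> bool" where
  "compat Q \<gamma> \<longleftrightarrow> degree Q = m \<and> (\<forall>f g t. degree f < m \<longrightarrow> degree g < m \<longrightarrow> Fin t \<le> \<nu> (f * g) \<longrightarrow>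
     Fin (t - \<gamma>) < \<nu> ((f * g) div Q) \<and> Fin t \<le> \<nu> ((f * g) mod Q))"

text \<open>The quotients of \<open>f * g\<close> by \<open>Q\<close> and by \<open>Q'\<close> have the same value, since they differ by
  the quotient of \<open>a * (Q' - Q)\<close> by \<open>Q\<close>, where \<open>a\<close> is the quotient of \<open>f * g\<close> by \<open>Q'\<close>.\<close>

lemma compat_shift:
  assumes Q: "Q \<in> Psi \<nu> m" and \<gamma>: "\<nu> Q = Fin \<gamma>"
    and Q': "degree Q' = m" "degree (Q' - Q) < m" "Fin \<gamma> \<le> \<nu> (Q' - Q)"
  shows "compat Q' \<gamma>"
  unfolding compat_def
proof (intro conjI allI impI Q'(1))
  fix f g t assume fg: "degree f < m" "degree g < m" "Fin t \<le> \<nu> (f * g)"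
  define a where "a = (f * g) div Q'"
  define b where "b = (f * g) mod Q'"
  define c where "c = Q' - Q"
  have deg: "degree Q = m" by (rule Psi_degree[OF Q])
  have da: "degree a < m" unfolding a_def by (rule div_small[OF Q'(1) fg(1,2)])
  have db: "degree b < m" unfolding b_def by (rule mod_small[OF Q'(1)])
  have eq: "f * g = a * Q' + b" by (simp add: a_def b_def)
  have "Fin (t - \<gamma>) < \<nu> a \<and> Fin t \<le> \<nu> b"
  proof (cases "a = 0")
    case True
    then show ?thesis using fg eq by simp
  next
    case anz: False
    then have fgnz: "f * g \<noteq> 0" by (auto simp: a_def)
    obtain \<phi> where \<phi>: "\<nu> f = Fin \<phi>" using finite_value[of f] fg fgnz by auto
    obtain \<psi> where \<psi>: "\<nu> g = Fin \<psi>" using finite_value[of g] fg fgnz by auto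
    define t' where "t' = \<phi> + \<psi>"
    have t': "\<nu> (f * g) = Fin t'" using \<phi> \<psi> by (simp add: nu_mult t'_def)
    have tt: "t \<le> t'" using fg(3) t' by simp
    obtain \<alpha> where \<alpha>: "\<nu> a = Fin \<alpha>" using finite_value[of a] anz da by auto
    have quot: "f * g div Q = a + (a * c) div Q"
    proof -
      have "f * g = a * Q + (a * c + b)" using eq by (simp add: c_def algebra_simps)
      then have "f * g div Q = a + (a * c + b) div Q"
        using Psi_nonzero[OF Q] by (metis add.commute div_mult_self1)
      then show ?thesis using db deg by (simp add: poly_div_add_left div_poly_less)
    qed
    have "Fin \<alpha> < \<nu> ((a * c) div Q) \<and> Fin (\<alpha> + \<gamma>) \<le> \<nu> (a * c)"
    proof (cases "c = 0")
      case False
      then obtain \<kappa> where \<kappa>: "\<nu> c = Fin \<kappa>" using finite_value[of c] Q'(2) by (auto simp: c_def)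
      then have "\<gamma> \<le> \<kappa>" using Q'(3) by (simp add: c_def)
      have ac: "\<nu> (a * c) = Fin (\<alpha> + \<kappa>)" using \<alpha> \<kappa> by (simp add: nu_mult)
      have "Fin (\<alpha> + \<kappa> - \<gamma>) < \<nu> ((a * c) div Q)"
        using Q'(2) by (intro key_div_gt[OF Q \<gamma> da _ ac]) (simp add: c_def)
      moreover have "Fin \<alpha> \<le> Fin (\<alpha> + \<kappa> - \<gamma>)" using \<open>\<gamma> \<le> \<kappa>\<close> by (simp add: algebra_simps)
      ultimately have "Fin \<alpha> < \<nu> ((a * c) div Q)" by (rule order.strict_trans1[rotated])
      then show ?thesis using ac \<open>\<gamma> \<le> \<kappa>\<close> by simp
    qed simp
    then have lt: "\<nu> a < \<nu> ((a * c) div Q)" using \<alpha> by simp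
    have "\<nu> (f * g div Q) = Fin \<alpha>" unfolding quot using nu_add_eq[OF lt] \<alpha> by simp
    then have *: "t' - \<gamma> < \<alpha>" using key_div_gt[OF Q \<gamma> fg(1,2) t'] by simp
    have "Fin t' \<le> \<nu> Q' + \<nu> a"
    proof -
      have "Fin \<gamma> \<le> \<nu> (c + Q)" using Q'(3) \<gamma> by (intro nu_add_ge) (auto simp: c_def)
      then have "Fin (\<gamma> + \<alpha>) \<le> \<nu> (Q' * a)" using \<alpha> by (intro nu_mult_ge) (auto simp: c_def)
      moreover have "t' \<le> \<gamma> + \<alpha>" using * by (simp add: algebra_simps)
      ultimately show ?thesis by (metis less_eq_extended.simps(1) nu_mult order.trans)
    qed
    then have "Fin t' \<le> \<nu> (f * g - Q' * a)" using t' by (intro nu_diff_ge) (auto simp: nu_mult)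
    then have "Fin t' \<le> \<nu> b" using eq by (simp add: mult.commute)
    moreover have "t - \<gamma> < \<alpha>" using * tt by (meson diff_right_mono order.strict_trans1)
    ultimately show ?thesis using \<alpha> tt by (auto intro: order.trans[rotated])
  qed
  then show "Fin (t - \<gamma>) < \<nu> ((f * g) div Q')" "Fin t \<le> \<nu> ((f * g) mod Q')"
    by (auto simp: a_def b_def)
qed

section \<open>Weighted lower bounds on expansion coefficients\<close>

text \<open>A bound for the Gauss-type function that gives \<open>Q\<close> the weight \<gamma> and
  takes the minimum over the terms of the expansion. A smaller weight makes the bound on the
  coefficients stronger.\<close>

definition wge :: "'k poly \<Rightarrow> 'g \<Rightarrow> 'g \<Rightarrow> 'k poly \<Rightarrow> bool" where
  "wge Q \<gamma> t f \<longleftrightarrow> (\<forall>i. Fin (t - nmul i \<gamma>) \<le> \<nu> (qcoeff Q f i))"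

lemma wge_0: "wge Q \<gamma> t 0"
  by (simp add: wge_def qcoeff_0)

lemma wge_add: "wge Q \<gamma> t f \<Longrightarrow> wge Q \<gamma> t g \<Longrightarrow> wge Q \<gamma> t (f + g)"
  by (simp add: wge_def qcoeff_add nu_add_ge)

lemma wge_sum: "(\<And>i. i \<in> A \<Longrightarrow> wge Q \<gamma> t (f i)) \<Longrightarrow> wge Q \<gamma> t (\<Sum>i\<in>A. f i)"
  by (induction A rule: infinite_finite_induct) (auto intro: wge_add wge_0)

lemma wge_of_nat_mult: "wge Q \<gamma> t f \<Longrightarrow> wge Q \<gamma> t (of_nat n * f)"
  by (induction n) (auto intro: wge_add wge_0 simp: distrib_right)

lemma wge_term:
  assumes "degree Q = m" "degree h < m" "Fin (t - nmul k \<gamma>) \<le> \<nu> h"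
  shows "wge Q \<gamma> t (h * Q ^ k)"
  using assms m_pos by (auto simp: wge_def qcoeff_mult_power qcoeff_small)

lemma wge_small:
  "degree Q = m \<Longrightarrow> degree h < m \<Longrightarrow> Fin t \<le> \<nu> h \<Longrightarrow> wge Q \<gamma> t h"
  using wge_term[of Q h t 0 \<gamma>] by simp

text \<open>A product of terms of indices \<open>i\<close> and \<open>j\<close> leaves a remainder
  at \<open>i + j\<close> and one carry at \<open>i + j + 1\<close>; \<open>compat\<close> says
  exactly that both respect the bound.\<close>

lemma wge_mult:
  assumes c: "compat Q \<gamma>" and f: "wge Q \<gamma> s f" and g: "wge Q \<gamma> t g"
  shows "wge Q \<gamma> (s + t) (f * g)"
proof -
  have deg: "degree Q = m" using c by (simp add: compat_def)
  then have deg1: "1 \<le> degree Q" using m_pos by simp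
  have small: "degree (qcoeff Q f i) < m" for f i using degree_qcoeff[OF deg1] deg by simp
  have *: "wge Q \<gamma> (s + t) ((qcoeff Q f i * Q ^ i) * (qcoeff Q g j * Q ^ j))" for i j
  proof -
    define p where "p = qcoeff Q f i * qcoeff Q g j"
    have "Fin ((s - nmul i \<gamma>) + (t - nmul j \<gamma>)) \<le> \<nu> p"
      unfolding p_def using f g by (intro nu_mult_ge) (auto simp: wge_def)
    then have "Fin (s + t - nmul (i + j) \<gamma>) \<le> \<nu> p" by (simp add: nmul_add_left algebra_simps)
    then have "Fin (s + t - nmul (i + j) \<gamma> - \<gamma>) \<le> \<nu> (p div Q)" "Fin (s + t - nmul (i + j) \<gamma>) \<le> \<nu> (p mod Q)"
      using c small unfolding compat_def p_def by (blast intro: less_imp_le)+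
    then have "wge Q \<gamma> (s + t) (p div Q * Q ^ Suc (i + j))" "wge Q \<gamma> (s + t) (p mod Q * Q ^ (i + j))"
      unfolding p_def
      by (auto intro!: wge_term deg div_small mod_small small simp: diff_diff_eq add.commute simp del: power_Suc)
    moreover have "(qcoeff Q f i * Q ^ i) * (qcoeff Q g j * Q ^ j)
        = p div Q * Q ^ Suc (i + j) + p mod Q * Q ^ (i + j)"
    proof -
      have "(qcoeff Q f i * Q ^ i) * (qcoeff Q g j * Q ^ j) = (p div Q * Q + p mod Q) * Q ^ (i + j)"
        by (simp add: p_def power_add mult_ac)
      then show ?thesis by (simp only: distrib_right power_Suc mult.assoc)
    qed
    ultimately show ?thesis by (auto intro: wge_add)
  qed
  have "f * g = (\<Sum>i\<le>degree f. \<Sum>j\<le>degree g. (qcoeff Q f i * Q ^ i) * (qcoeff Q g j * Q ^ j))"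
    unfolding sum_product[symmetric]
    by (rule arg_cong2[where f = times, OF qexpansion[OF deg1, of f] qexpansion[OF deg1, of g]])
  then show ?thesis using * by (auto intro!: wge_sum)
qed

lemma wge_power: "compat Q \<gamma> \<Longrightarrow> wge Q \<gamma> t f \<Longrightarrow> wge Q \<gamma> (nmul n t) (f ^ n)"
proof (induction n)
  case 0
  then show ?case using wge_small[of Q 1 0 \<gamma>] m_pos by (simp add: compat_def nu_1)
next
  case (Suc n)
  then show ?case using wge_mult[of Q \<gamma> t f "nmul n t" "f ^ n"] by simp
qed

end

section \<open>Values in the divisible hull and change of key polynomial\<close>

context poly_val
begin

section \<open>The value group and its divisible hull as groups\<close>

lemma vK_0: "0 \<in> vK \<nu>"
  unfolding vK_def using nu_1 by (auto simp: one_pCons intro: exI[of _ 1])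

lemma vK_add: "x \<in> vK \<nu> \<Longrightarrow> y \<in> vK \<nu> \<Longrightarrow> x + y \<in> vK \<nu>"
proof -
  assume "x \<in> vK \<nu>" "y \<in> vK \<nu>"
  then obtain a b where ab: "a \<noteq> 0" "\<nu> [:a:] = Fin x" "b \<noteq> 0" "\<nu> [:b:] = Fin y"
    by (auto simp: vK_def)
  then have "\<nu> [:a * b:] = Fin (x + y)" using nu_mult[of "[:a:]" "[:b:]"] by (simp add: mult.commute)
  then show ?thesis using ab by (auto simp: vK_def intro!: exI[of _ "a * b"])
qed

lemma vK_minus: "x \<in> vK \<nu> \<Longrightarrow> - x \<in> vK \<nu>"
proof -
  assume "x \<in> vK \<nu>"
  then obtain a where a: "a \<noteq> 0" "\<nu> [:a:] = Fin x" by (auto simp: vK_def)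
  have "Fin x + \<nu> [:inverse a:] = Fin 0"
    using nu_mult[of "[:a:]" "[:inverse a:]"] a nu_1 by (simp add: one_pCons)
  then have "\<nu> [:inverse a:] = Fin (- x)"
    by (cases "\<nu> [:inverse a:]") (auto simp: add_eq_0_iff)
  then show ?thesis using a by (auto simp: vK_def intro!: exI[of _ "inverse a"])
qed

lemma vK_nmul: "x \<in> vK \<nu> \<Longrightarrow> nmul n x \<in> vK \<nu>"
  by (induction n) (auto intro: vK_0 vK_add)

lemma Gam_add: "x \<in> Gam \<nu> \<Longrightarrow> y \<in> Gam \<nu> \<Longrightarrow> x + y \<in> Gam \<nu>"
proof -
  assume "x \<in> Gam \<nu>" "y \<in> Gam \<nu>"
  then obtain n k where n: "n > 0" "nmul n x \<in> vK \<nu>" and k: "k > 0" "nmul k y \<in> vK \<nu>"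
    by (auto simp: Gam_def)
  have "nmul (n * k) (x + y) = nmul k (nmul n x) + nmul n (nmul k y)"
    by (simp add: nmul_add_right nmul_mult[symmetric] mult.commute)
  also have "\<dots> \<in> vK \<nu>" by (rule vK_add[OF vK_nmul[OF n(2)] vK_nmul[OF k(2)]])
  finally show ?thesis using n k unfolding Gam_def by (intro CollectI exI[of _ "n * k"]) simp
qed

lemma Gam_minus: "x \<in> Gam \<nu> \<Longrightarrow> - x \<in> Gam \<nu>"
  by (auto simp: Gam_def nmul_minus intro: vK_minus)

lemma Gam_diff: "x \<in> Gam \<nu> \<Longrightarrow> y \<in> Gam \<nu> \<Longrightarrow> x - y \<in> Gam \<nu>"
  using Gam_add[of x "- y"] Gam_minus[of y] by simp

lemma Gam_0: "0 \<in> Gam \<nu>"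
  unfolding Gam_def using vK_0 by (auto intro: exI[of _ 1])

lemma Gam_nmul: "x \<in> Gam \<nu> \<Longrightarrow> nmul n x \<in> Gam \<nu>"
  by (induction n) (auto intro: Gam_0 Gam_add)

text \<open>The unique term of least value cannot be cancelled by the others.\<close>

lemma sum_nonzero_distinct_values:
  assumes "finite A" "A \<noteq> {}" "\<And>i. i \<in> A \<Longrightarrow> \<nu> (f i) = Fin (w i)" "inj_on w A"
  shows "(\<Sum>i\<in>A. f i) \<noteq> 0"
proof
  assume 0: "(\<Sum>i\<in>A. f i) = 0"
  have "Min (w ` A) \<in> w ` A" using assms by (intro Min_in) auto
  then obtain i where i: "i \<in> A" "w i = Min (w ` A)" by auto
  have "Fin (w i) < \<nu> (\<Sum>j\<in>A - {i}. f j)"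
  proof (rule nu_sum_gt)
    fix j assume j: "j \<in> A - {i}"
    then have "w i \<le> w j" "w i \<noteq> w j" using i assms by (auto dest: inj_onD)
    then show "Fin (w i) < \<nu> (f j)" using assms(3) j by simp
  qed
  moreover have "(\<Sum>j\<in>A - {i}. f j) = - f i"
    using 0 sum.remove[OF assms(1) i(1), of f] by (simp add: add_eq_0_iff)
  ultimately show False using assms(3)[OF i(1)] by simp
qed

end

text \<open>These are \<open>n + 1\<close> vectors in the \<open>n\<close>-dimensional space of
  polynomials of degree below \<open>n\<close>. Injectivity turns a relation on the set of vectors
  into one on the indexed family.\<close>

lemma poly_linear_dependence:
  fixes b :: "nat \<Rightarrow> 'k::field poly"
  assumes deg: "\<And>i. i \<le> n \<Longrightarrow> degree (b i) < n" and inj: "inj_on b {..n}"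
  obtains c where "\<exists>i\<le>n. c i \<noteq> 0" "(\<Sum>i\<le>n. smult (c i) (b i)) = 0"
proof -
  interpret vs: vector_space "smult :: 'k \<Rightarrow> 'k poly \<Rightarrow> 'k poly"
    by unfold_locales (auto simp: smult_add_right smult_add_left)
  define T where "T = (\<lambda>i. monom (1::'k) i) ` {..<n}"
  have "b i \<in> vs.span T" if "i \<le> n" for i
  proof -
    have "b i = (\<Sum>j<n. smult (coeff (b i) j) (monom 1 j))"
    proof -
      have "{..n - 1} = {..<n}" using deg[OF that] by auto
      then show ?thesis
        using poly_as_sum_of_monoms'[of "b i" "n - 1"] deg[OF that] by (simp add: smult_monom)
    qed
    also have "\<dots> \<in> vs.span T"
      by (intro vs.span_sum vs.span_scale vs.span_base) (auto simp: T_def)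
    finally show ?thesis .
  qed
  then have sub: "b ` {..n} \<subseteq> vs.span T" by auto
  have "card T \<le> n" unfolding T_def using card_image_le[of "{..<n}" "\<lambda>i. monom (1::'k) i"] by simp
  moreover have "card (b ` {..n}) = Suc n" using inj by (simp add: card_image)
  ultimately have "vs.dependent (b ` {..n})"
    using vs.independent_span_bound[of T "b ` {..n}"] sub by (auto simp: T_def)
  then obtain u where u: "\<exists>v\<in>b ` {..n}. u v \<noteq> 0" "(\<Sum>v\<in>b ` {..n}. smult (u v) v) = 0"
    using vs.dependent_finite[of "b ` {..n}"] by auto
  show ?thesis
    by (rule that[of "u \<circ> b"]) (use u inj in \<open>auto simp: sum.reindex\<close>)
qed

context key_val
begin

text \<open>The powers of \<open>f\<close> modulo \<open>Q\<close> have the values of the powers of \<open>f\<close>, and are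
  linearly dependent over the constants.\<close>

lemma small_value_in_Gam:
  assumes Q: "Q \<in> Psi \<nu> m" and f: "degree f < m" "\<nu> f = Fin \<phi>"
  shows "\<phi> \<in> Gam \<nu>"
proof (rule ccontr)
  assume notin: "\<phi> \<notin> Gam \<nu>"
  have deg: "degree Q = m" by (rule Psi_degree[OF Q])
  obtain \<gamma> where \<gamma>: "\<nu> Q = Fin \<gamma>"
    using finite_value[of Q] Psi_nonzero[OF Q] deg by auto
  define b where "b i = f ^ i mod Q" for i
  have db: "degree (b i) < m" for i unfolding b_def by (rule mod_small[OF deg])
  have nb: "\<nu> (b i) = Fin (nmul i \<phi>)" for i
  proof (induction i)
    case 0
    then show ?case using deg m_pos nu_1 by (simp add: b_def mod_poly_less)
  next
    case (Suc i)
    have "b (Suc i) = (f * b i) mod Q" by (simp add: b_def mod_mult_right_eq)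
    moreover have "\<nu> (f * b i) = Fin (nmul (Suc i) \<phi>)" using Suc f by (simp add: nu_mult)
    ultimately show ?case using key_mod_ge[OF Q \<gamma> f(1) db] by simp
  qed
  \<comment> \<open>The values of distinct powers lie in distinct cosets of \<open>vK\<close>: a
    coincidence would put a positive multiple of \<phi> into \<open>vK\<close>.\<close>
  have indep: "x + nmul i \<phi> \<noteq> y + nmul j \<phi>" if "x \<in> vK \<nu>" "y \<in> vK \<nu>" "i < j" for x y i j
  proof
    assume "x + nmul i \<phi> = y + nmul j \<phi>"
    then have "nmul (j - i) \<phi> = x - y" using that by (simp add: nmul_diff_left algebra_simps)
    also have "\<dots> \<in> vK \<nu>" using vK_add[OF that(1) vK_minus[OF that(2)]] by simp
    finally show False using notin that(3) unfolding Gam_def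
      by (metis (mono_tags, lifting) mem_Collect_eq zero_less_diff)
  qed
  have "inj_on b {..m}"
  proof (rule inj_onI)
    fix i j assume "b i = b j"
    then have "0 + nmul i \<phi> = 0 + nmul j \<phi>" using nb[of i] nb[of j] by simp
    then show "i = j" using indep[OF vK_0 vK_0, of i j] indep[OF vK_0 vK_0, of j i]
      by (metis nat_neq_iff)
  qed
  then obtain c where c: "\<exists>i\<le>m. c i \<noteq> 0" "(\<Sum>i\<le>m. smult (c i) (b i)) = 0"
    using poly_linear_dependence[of m b] db by auto
  define A where "A = {i \<in> {..m}. c i \<noteq> 0}"
  have "\<exists>x. \<nu> [:c i:] = Fin x" if "i \<in> A" for i
    using finite_value[of "[:c i:]"] that by (auto simp: A_def)
  then obtain x where x: "\<And>i. i \<in> A \<Longrightarrow> \<nu> [:c i:] = Fin (x i)" by metis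
  have xv: "x i \<in> vK \<nu>" if "i \<in> A" for i using x[OF that] that by (auto simp: vK_def A_def)
  have "(\<Sum>i\<in>A. smult (c i) (b i)) \<noteq> 0"
  proof (rule sum_nonzero_distinct_values)
    show "finite A" "A \<noteq> {}" using c by (auto simp: A_def)
    show "\<nu> (smult (c i) (b i)) = Fin (x i + nmul i \<phi>)" if "i \<in> A" for i
      using nu_mult[of "[:c i:]" "b i"] x[OF that] nb[of i] by simp
    show "inj_on (\<lambda>i. x i + nmul i \<phi>) A"
      by (rule inj_onI) (metis indep nat_neq_iff xv)
  qed
  moreover have "(\<Sum>i\<in>A. smult (c i) (b i)) = (\<Sum>i\<le>m. smult (c i) (b i))"
    unfolding A_def by (intro sum.mono_neutral_left) auto
  ultimately show False using c by simp
qed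

section \<open>Comparing expansions with respect to two key polynomials\<close>

text \<open>The default \<open>0\<close> never occurs on \<open>Psi \<nu> m\<close>, where values
  are finite by \<open>nu_gam\<close>.\<close>

definition gam :: "'k poly \<Rightarrow> 'g" where
  "gam Q = (case \<nu> Q of Fin x \<Rightarrow> x | _ \<Rightarrow> 0)"

lemma nu_gam:
  assumes "Q \<in> Psi \<nu> m"
  shows "\<nu> Q = Fin (gam Q)"
proof -
  obtain x where "\<nu> Q = Fin x"
    by (rule finite_value[of Q]) (use assms Psi_nonzero Psi_degree in auto)
  then show ?thesis by (simp add: gam_def)
qed

lemma Psi_diff:
  assumes Q: "Q \<in> Psi \<nu> m" and Q': "Q' \<in> Psi \<nu> m"
  shows "degree (Q' - Q) < m"
proof -
  have "coeff (Q' - Q) m = 0"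
    using Psi_monic[OF Q] Psi_monic[OF Q'] Psi_degree[OF Q] Psi_degree[OF Q'] by simp
  moreover have "degree (Q' - Q) \<le> m"
    using Psi_degree[OF Q] Psi_degree[OF Q'] by (simp add: degree_diff_le)
  ultimately show ?thesis using m_pos
    by (metis degree_0 le_neq_implies_less leading_coeff_0_iff less_eq_Suc_le One_nat_def)
qed

text \<open>The difference of the two key polynomials has degree below \<open>m\<close> and value at
  least \<open>gam Q\<close>, so \<open>compat_shift\<close> applies.\<close>

lemma compat_Psi:
  assumes Q: "Q \<in> Psi \<nu> m" and Q': "Q' \<in> Psi \<nu> m" and le: "gam Q \<le> gam Q'"
  shows "compat Q' (gam Q)"
proof (rule compat_shift[OF Q nu_gam[OF Q] Psi_degree[OF Q'] Psi_diff[OF Q Q']])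
  show "Fin (gam Q) \<le> \<nu> (Q' - Q)"
    using le nu_gam[OF Q] nu_gam[OF Q'] by (intro nu_diff_ge) auto
qed

text \<open>The difference between \<open>Q\<close> and a key polynomial of larger value has value
  \<open>gam Q\<close> and degree below \<open>m\<close>, so \<open>small_value_in_Gam\<close>
  applies.\<close>

lemma gam_in_Gam:
  assumes Q: "Q \<in> Psi \<nu> m"
  shows "gam Q \<in> Gam \<nu>"
proof -
  obtain P where P: "P \<in> Psi \<nu> m" "\<nu> Q < \<nu> P" using Psi_nomax Q not_le by blast
  have "\<nu> (- Q + P) = \<nu> (- Q)" using P by (intro nu_add_eq) simp
  then have "\<nu> (P - Q) = Fin (gam Q)" using nu_gam[OF Q] by simp
  then show ?thesis using small_value_in_Gam[OF Q Psi_diff[OF Q P(1)]] by simp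
qed

lemma wge_Psi:
  assumes Q: "Q \<in> Psi \<nu> m" and Q': "Q' \<in> Psi \<nu> m" and le: "gam Q \<le> gam Q'"
  shows "wge Q' (gam Q) (gam Q) Q"
proof -
  have deg: "degree Q' = m" by (rule Psi_degree[OF Q'])
  have "Fin (gam Q) \<le> \<nu> (Q - Q')"
    using le nu_gam[OF Q] nu_gam[OF Q'] by (intro nu_diff_ge) auto
  then have "wge Q' (gam Q) (gam Q) (Q - Q')" using deg Psi_diff[OF Q' Q] by (intro wge_small)
  moreover have "wge Q' (gam Q) (gam Q) (1 * Q' ^ 1)"
    using deg m_pos nu_1 by (intro wge_term) auto
  ultimately show ?thesis using wge_add by fastforce
qed

lemma wge_mono_gam:
  assumes "wge Q \<gamma> t f" "\<gamma> \<le> \<gamma>'"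
  shows "wge Q \<gamma>' t f"
  unfolding wge_def
proof
  fix i
  have "Fin (t - nmul i \<gamma>') \<le> Fin (t - nmul i \<gamma>)" using nmul_mono[OF assms(2)] by (simp add: diff_left_mono)
  also have "\<dots> \<le> \<nu> (qcoeff Q f i)" using assms(1) by (simp add: wge_def)
  finally show "Fin (t - nmul i \<gamma>') \<le> \<nu> (qcoeff Q f i)" .
qed

lemma wge_term_Psi:
  assumes Q: "Q \<in> Psi \<nu> m" and Q': "Q' \<in> Psi \<nu> m" and le: "gam Q \<le> gam Q'"
    and h: "degree h < m" "Fin (t - nmul k (gam Q)) \<le> \<nu> h"
  shows "wge Q' (gam Q) t (h * Q ^ k)"
proof -
  have c: "compat Q' (gam Q)" by (rule compat_Psi[OF Q Q' le])
  have "wge Q' (gam Q) (t - nmul k (gam Q) + nmul k (gam Q)) (h * Q ^ k)"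
    using c h by (intro wge_mult wge_power wge_Psi Q Q' le wge_small) (auto simp: compat_def)
  then show ?thesis by simp
qed

text \<open>The terms of the \<open>Q\<close>-expansion are rewritten in powers of \<open>Q'\<close>
  by multiplicativity. The weight stays that of \<open>Q\<close>, which later yields strict gains
  when \<open>gam Q < gam Q'\<close>.\<close>

lemma wge_change_Q:
  assumes Q: "Q \<in> Psi \<nu> m" and Q': "Q' \<in> Psi \<nu> m" and le: "gam Q \<le> gam Q'"
    and f: "wge Q (gam Q) t f"
  shows "wge Q' (gam Q) t f"
proof -
  have deg: "1 \<le> degree Q" using Psi_degree[OF Q] m_pos by simp
  have "wge Q' (gam Q) t (\<Sum>i\<le>degree f. qcoeff Q f i * Q ^ i)"
    using f degree_qcoeff[OF deg] Psi_degree[OF Q]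
    by (intro wge_sum wge_term_Psi Q Q' le) (auto simp: wge_def)
  then show ?thesis by (simp only: qexpansion[OF deg, of f, symmetric])
qed

lemma Fin_diff_le_iff: "Fin (t - x) \<le> y \<longleftrightarrow> Fin t \<le> y + Fin (x::'g)"
  by (cases y) (auto simp: algebra_simps)

text \<open>Links truncations with weighted bounds; indices beyond \<open>degree f\<close>, absent
  from the minimum in \<open>nuQ\<close>, have zero coefficients.\<close>

lemma nuQ_ge_iff:
  assumes Q: "Q \<in> Psi \<nu> m"
  shows "Fin t \<le> nuQ \<nu> Q f \<longleftrightarrow> wge Q (gam Q) t f"
proof -
  have deg: "degree Q = m" by (rule Psi_degree[OF Q])
  have "Fin t \<le> nuQ \<nu> Q f \<longleftrightarrow> (\<forall>i\<in>{0..degree f}. Fin t \<le> \<nu> (qcoeff Q f i * Q ^ i))"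
    unfolding nuQ_def by (subst Min_ge_iff) auto
  also have "\<dots> \<longleftrightarrow> (\<forall>i\<in>{0..degree f}. Fin (t - nmul i (gam Q)) \<le> \<nu> (qcoeff Q f i))"
    by (simp add: nu_mult nu_power nu_gam[OF Q] nmul_Fin Fin_diff_le_iff)
  also have "\<dots> \<longleftrightarrow> wge Q (gam Q) t f"
  proof -
    have "qcoeff Q f i = 0" if "degree f < i" for i
    proof (rule qcoeff_eq_0)
      have "degree f < i * 1" using that by simp
      also have "\<dots> \<le> i * degree Q" using deg m_pos by (intro mult_le_mono) auto
      finally show "degree f < i * degree Q" .
    qed
    then have "Fin (t - nmul i (gam Q)) \<le> \<nu> (qcoeff Q f i)" if "degree f < i" for i
      using that by simp
    then show ?thesis unfolding wge_def by (metis atLeastAtMost_iff le0 not_le)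
  qed
  finally show ?thesis .
qed

lemma nuQ_not_Minf: "nuQ \<nu> Q f \<noteq> Minf"
proof -
  have "nuQ \<nu> Q f \<in> (\<lambda>i. \<nu> (qcoeff Q f i * Q ^ i)) ` {0..degree f}"
    unfolding nuQ_def by (intro Min_in) auto
  then obtain i where "nuQ \<nu> Q f = \<nu> (qcoeff Q f i * Q ^ i)" by blast
  then show ?thesis by (simp add: nu_Minf)
qed

lemma nuQ_finite:
  assumes Q: "Q \<in> Psi \<nu> m" and "f \<noteq> 0"
  obtains x where "nuQ \<nu> Q f = Fin x"
proof -
  have deg: "1 \<le> degree Q" using Psi_degree[OF Q] m_pos by simp
  obtain i where i: "i \<le> degree f" "qcoeff Q f i \<noteq> 0"
    using qexpansion[OF deg, of f] \<open>f \<noteq> 0\<close> by (metis (no_types, lifting) atMost_iff mult_zero_left sum.neutral)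
  obtain x where x: "\<nu> (qcoeff Q f i) = Fin x"
    using finite_value[OF i(2)] degree_qcoeff[OF deg, of f i] Psi_degree[OF Q] by auto
  have "nuQ \<nu> Q f \<le> \<nu> (qcoeff Q f i * Q ^ i)" unfolding nuQ_def using i by (intro Min_le) auto
  also have "\<dots> = Fin (x + nmul i (gam Q))" using x by (simp add: nu_mult nu_power nu_gam[OF Q] nmul_Fin)
  finally show ?thesis using that nuQ_not_Minf[of Q f] by (cases "nuQ \<nu> Q f") auto
qed

text \<open>First the expansion is changed with the weight kept, then the weight is raised to
  \<open>gam Q'\<close>.\<close>

lemma nuQ_mono:
  assumes Q: "Q \<in> Psi \<nu> m" and Q': "Q' \<in> Psi \<nu> m" and le: "gam Q \<le> gam Q'"
  shows "nuQ \<nu> Q f \<le> nuQ \<nu> Q' f"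
proof (cases "f = 0")
  case True
  have "nuQ \<nu> Q' 0 = Pinf" unfolding nuQ_def by (simp add: qcoeff_0)
  then show ?thesis using True by simp
next
  case False
  obtain x where x: "nuQ \<nu> Q f = Fin x" by (rule nuQ_finite[OF Q False])
  then have "wge Q (gam Q) x f" using nuQ_ge_iff[OF Q, of x f] by simp
  then have "wge Q' (gam Q') x f" using wge_mono_gam[OF wge_change_Q[OF Q Q' le] le] by simp
  then show ?thesis using x nuQ_ge_iff[OF Q'] by simp
qed

end

section \<open>Vertical unboundedness and the top coefficient\<close>

text \<open>Bernoulli's inequality \<open>(1 + 1/b)^r \<ge> 1 + r/b\<close>, multiplied by
  \<open>b^(r+1)\<close>.\<close>

lemma bernoulli_nat: "b ^ r * (b + r) \<le> b * (b + 1) ^ r" for b r :: nat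
proof (induction r)
  case (Suc r)
  have "b ^ Suc r * (b + Suc r) \<le> (b + 1) * (b ^ r * (b + r))"
    by (simp add: algebra_simps)
  also have "\<dots> \<le> (b + 1) * (b * (b + 1) ^ r)" using Suc by (rule mult_le_mono2)
  finally show ?case by (simp add: algebra_simps)
qed simp

text \<open>The failing instance provides \<open>x\<close> and one rational \<open>q > 1\<close> by
  which every distance from \<open>x\<close> can be stretched inside \<open>L\<close>. As
  \<open>q\<close> is at least \<open>(B + 1) / B\<close> for its denominator \<open>B\<close>,
  iteration reaches every factor \<open>n\<close>.\<close>

lemma not_vert_boundedE:
  fixes L :: "'g::linordered_ab_group_add set"
  assumes div: "divisible_group TYPE('g)" and "\<not> vert_bounded L"
  obtains x where "x \<in> L"
    "\<And>n y. y \<in> L \<Longrightarrow> x \<le> y \<Longrightarrow> \<exists>z\<in>L. x \<le> z \<and> nmul n (y - x) \<le> z - x"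
proof -
  obtain x q where x: "x \<in> L" and q: "1 < q"
    and far: "\<And>y. y \<in> L \<Longrightarrow> \<exists>z\<in>L. \<not> z - x < qsmul q (y - x)"
    using assms(2) unfolding vert_bounded_def by blast
  obtain a b where ab: "quotient_of q = (a, b)" by force
  have b: "b > 0" using quotient_of_denom_pos[OF ab] .
  have "b < a" using q quotient_of_div[OF ab] b by (simp add: field_simps)
  define B where "B = nat b"
  have B: "B > 0" "B + 1 \<le> nat a" using b \<open>b < a\<close> by (auto simp: B_def)
  have step: "\<exists>z\<in>L. x \<le> z \<and> nmul (B + 1) (y - x) \<le> nmul B (z - x)" if y: "y \<in> L" "x \<le> y" for y
  proof -
    obtain z where z: "z \<in> L" "qsmul q (y - x) \<le> z - x" using far[OF y(1)] by (auto simp: not_less)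
    have "nmul B (qsmul q (y - x)) = nmul (nat a) (y - x)"
      using nmul_gdiv[OF div B(1)] b \<open>b < a\<close> by (simp add: qsmul_def ab B_def zmul_def)
    then have "nmul (nat a) (y - x) \<le> nmul B (z - x)" using nmul_mono[OF z(2), of B] by simp
    moreover have "nmul (B + 1) (y - x) \<le> nmul (nat a) (y - x)"
      using B y by (intro nmul_mono_left) auto
    ultimately have *: "nmul (B + 1) (y - x) \<le> nmul B (z - x)" by (rule order.trans[rotated])
    have "0 \<le> nmul (B + 1) (y - x)" using y by (intro nmul_nonneg) simp
    then have "nmul B 0 \<le> nmul B (z - x)" using * by simp
    then have "x \<le> z" unfolding nmul_le_iff[OF B(1)] by simp
    then show ?thesis using * z(1) by blast
  qed
  have iter: "\<exists>z\<in>L. x \<le> z \<and> nmul ((B + 1) ^ r) (y - x) \<le> nmul (B ^ r) (z - x)"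
    if y: "y \<in> L" "x \<le> y" for y r
  proof (induction r)
    case 0
    then show ?case using y by auto
  next
    case (Suc r)
    then obtain z where z: "z \<in> L" "x \<le> z" "nmul ((B + 1) ^ r) (y - x) \<le> nmul (B ^ r) (z - x)" by blast
    obtain z' where z': "z' \<in> L" "x \<le> z'" "nmul (B + 1) (z - x) \<le> nmul B (z' - x)"
      using step[OF z(1,2)] by blast
    have "nmul ((B + 1) ^ Suc r) (y - x) = nmul (B + 1) (nmul ((B + 1) ^ r) (y - x))"
      by (simp only: power_Suc nmul_mult)
    also have "\<dots> \<le> nmul (B + 1) (nmul (B ^ r) (z - x))" by (rule nmul_mono[OF z(3)])
    also have "\<dots> = nmul (B ^ r) (nmul (B + 1) (z - x))"
      by (simp only: nmul_mult[symmetric] mult.commute)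
    also have "\<dots> \<le> nmul (B ^ r) (nmul B (z' - x))" by (rule nmul_mono[OF z'(3)])
    also have "\<dots> = nmul (B ^ Suc r) (z' - x)" by (simp only: nmul_mult[symmetric] power_Suc2)
    finally show ?case using z' by blast
  qed
  have "\<exists>z\<in>L. x \<le> z \<and> nmul n (y - x) \<le> z - x" if y: "y \<in> L" "x \<le> y" for y n
  proof -
    \<comment> \<open>With this number of iterations, Bernoulli's inequality gives a total factor of
      at least \<open>1 + n\<close>.\<close>
    define r where "r = n * B"
    have "B * (B ^ r * (1 + n)) \<le> B * (B + 1) ^ r"
      using bernoulli_nat[of B r] by (simp add: r_def algebra_simps)
    then have "B ^ r * (1 + n) \<le> (B + 1) ^ r" using B(1) by (simp only: mult_le_cancel1)
    then have le: "B ^ r * n \<le> (B + 1) ^ r" by simp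
    obtain z where z: "z \<in> L" "x \<le> z" "nmul ((B + 1) ^ r) (y - x) \<le> nmul (B ^ r) (z - x)"
      using iter[OF y] by blast
    have "nmul (B ^ r) (nmul n (y - x)) \<le> nmul ((B + 1) ^ r) (y - x)"
      unfolding nmul_mult[symmetric] using le y by (intro nmul_mono_left) auto
    also note z(3)
    finally have "nmul n (y - x) \<le> z - x" using B(1) by (simp add: nmul_le_iff)
    then show ?thesis using z by blast
  qed
  then show ?thesis using that x by blast
qed

text \<open>A nonzero quotient of \<open>f\<close> by \<open>Q ^ i\<close> has degree
  \<open>degree f - i * degree Q\<close>, and reduction modulo \<open>Q\<close> does not raise
  it.\<close>

lemma degree_qcoeff_bound:
  assumes "qcoeff Q f i \<noteq> 0" "1 \<le> degree Q"
  shows "degree (qcoeff Q f i) + i * degree Q \<le> degree f"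
proof -
  define h where "h = f div Q ^ i"
  have Q: "Q \<noteq> 0" "Q ^ i \<noteq> 0" using assms by auto
  have h: "h \<noteq> 0" using assms(1) by (auto simp: qcoeff_def h_def)
  have eq: "f = h * Q ^ i + f mod Q ^ i" unfolding h_def by (rule div_mult_mod_eq[symmetric])
  have dh: "degree (h * Q ^ i) = degree h + i * degree Q"
    using h Q by (simp add: degree_mult_eq degree_power_eq)
  have "degree f = degree (h * Q ^ i)"
  proof (cases "f mod Q ^ i = 0")
    case True
    then have "f = h * Q ^ i" using eq by (metis add_0_right)
    then show ?thesis by (rule arg_cong)
  next
    case False
    then have "degree (f mod Q ^ i) < degree (h * Q ^ i)"
      using degree_mod_less[OF Q(2), of f] dh Q by (simp add: degree_power_eq)
    then have "degree (h * Q ^ i + f mod Q ^ i) = degree (h * Q ^ i)" by (rule degree_add_eq_left)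
    then show ?thesis by (simp only: eq[symmetric])
  qed
  moreover have "degree (qcoeff Q f i) \<le> degree h"
  proof (cases "degree h < degree Q")
    case True
    then show ?thesis by (simp add: qcoeff_def h_def[symmetric] mod_poly_less)
  next
    case False
    then show ?thesis using degree_qcoeff[OF assms(2), of f i] by simp
  qed
  ultimately show ?thesis using dh by simp
qed

context key_val
begin

section \<open>Ultimate constancy of the coefficient of index \<open>degQ\<close>\<close>

text \<open>Induction on \<open>k\<close>, replacing one factor \<open>Q\<close> by
  \<open>Q' + e\<close>: the summand with \<open>Q'\<close> shifts the known coefficient, and the
  summand with \<open>e\<close> contributes only a carry of strictly larger value.\<close>

lemma qcoeff_term_top:
  assumes Q: "Q \<in> Psi \<nu> m" and Q': "Q' \<in> Psi \<nu> m" and le: "gam Q \<le> gam Q'"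
    and g: "degree g < m" "Fin y \<le> \<nu> g"
  shows "Fin y < \<nu> (qcoeff Q' (g * Q ^ k) k - g)"
proof (induction k)
  case 0
  then show ?case using g Psi_degree[OF Q'] by (simp add: mod_poly_less)
next
  case (Suc k)
  define P where "P = g * Q ^ k"
  define e where "e = Q - Q'"
  have deg: "degree Q = m" "degree Q' = m" using Psi_degree Q Q' by auto
  have deg1: "1 \<le> degree Q'" using deg m_pos by simp
  have de: "degree e < m" unfolding e_def by (rule Psi_diff[OF Q' Q])
  have ne: "Fin (gam Q) \<le> \<nu> e"
    unfolding e_def using le nu_gam[OF Q] nu_gam[OF Q'] by (intro nu_diff_ge) auto
  have dP: "degree P < Suc k * m"
  proof -
    have "degree P \<le> degree g + degree (Q ^ k)" unfolding P_def by (rule degree_mult_le)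
    also have "degree (Q ^ k) = k * m" using Psi_nonzero[OF Q] deg by (simp add: degree_power_eq)
    finally show ?thesis using g(1) by simp
  qed
  have "Fin y \<le> \<nu> ((qcoeff Q' P k - g) + g)"
    using Suc g unfolding P_def by (intro nu_add_ge) auto
  then have pk: "Fin y \<le> \<nu> (qcoeff Q' P k)" by simp
  have "Fin y < \<nu> (qcoeff Q' (P * e) (Suc k))"
  proof -
    have "P * e = (\<Sum>j\<le>degree P. (qcoeff Q' P j * e) * Q' ^ j)"
    proof -
      have "P * e = (\<Sum>j\<le>degree P. qcoeff Q' P j * Q' ^ j) * e"
        by (rule arg_cong[where f = "\<lambda>p. p * e", OF qexpansion[OF deg1]])
      also have "\<dots> = (\<Sum>j\<le>degree P. (qcoeff Q' P j * e) * Q' ^ j)"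
        unfolding sum_distrib_right by (intro sum.cong refl) (simp only: mult_ac)
      finally show ?thesis .
    qed
    then have "qcoeff Q' (P * e) (Suc k) = (\<Sum>j\<le>degree P. qcoeff Q' ((qcoeff Q' P j * e) * Q' ^ j) (Suc k))"
      by (simp only: qcoeff_sum)
    moreover have "Fin y < \<nu> (qcoeff Q' ((qcoeff Q' P j * e) * Q' ^ j) (Suc k))" for j
    proof -
      have dj: "degree (qcoeff Q' P j) < m" using degree_qcoeff[OF deg1] deg by simp
      \<comment> \<open>Below \<open>k\<close> a single carry cannot reach index
        \<open>k + 1\<close>; at \<open>k\<close> the carry is bounded by \<open>compat\<close>;
        above \<open>k\<close> the coefficient vanishes because \<open>P\<close> has degree below
        \<open>(k + 1) * m\<close>.\<close>
      consider "j < k" | "j = k" | "k < j" by linarith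
      then show ?thesis
      proof cases
        case 1
        have "degree (qcoeff Q' P j * e) < 2 * m" using dj de degree_mult_le[of "qcoeff Q' P j" e] by simp
        also have "\<dots> \<le> (Suc k - j) * degree Q'" unfolding deg using 1 by (intro mult_le_mono1) simp
        finally have "qcoeff Q' (qcoeff Q' P j * e) (Suc k - j) = 0" by (rule qcoeff_eq_0)
        then show ?thesis using 1 deg1 by (simp add: qcoeff_mult_power)
      next
        case 2
        have "Fin (y + gam Q) \<le> \<nu> (qcoeff Q' P k * e)" by (rule nu_mult_ge[OF pk ne])
        then have "Fin (y + gam Q - gam Q) < \<nu> ((qcoeff Q' P k * e) div Q')"
          using compat_Psi[OF Q Q' le] dj de 2 unfolding compat_def by blast
        moreover have "degree ((qcoeff Q' P k * e) div Q') < m"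
          using dj de 2 by (intro div_small deg) auto
        ultimately show ?thesis using 2 deg deg1
          by (simp add: qcoeff_mult_power) (simp add: qcoeff_def mod_poly_less)
      next
        case 3
        have "Suc k * m \<le> j * degree Q'" unfolding deg using 3 by (intro mult_le_mono1) simp
        then have "qcoeff Q' P j = 0" using dP by (intro qcoeff_eq_0) simp
        then show ?thesis by (simp add: qcoeff_0)
      qed
    qed
    ultimately show ?thesis by (simp add: nu_sum_gt)
  qed
  moreover have "qcoeff Q' (g * Q ^ Suc k) (Suc k) = qcoeff Q' P k + qcoeff Q' (P * e) (Suc k)"
  proof -
    have "g * Q ^ Suc k = P * Q' ^ 1 + P * e" by (simp add: P_def e_def algebra_simps)
    then have "qcoeff Q' (g * Q ^ Suc k) (Suc k) = qcoeff Q' (P * Q' ^ 1) (Suc k) + qcoeff Q' (P * e) (Suc k)"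
      by (simp only: qcoeff_add)
    moreover have "qcoeff Q' (P * Q' ^ 1) (Suc k) = qcoeff Q' P k"
      unfolding qcoeff_mult_power[OF deg1] by simp
    ultimately show ?thesis by (simp only:)
  qed
  moreover have "Fin y < \<nu> (qcoeff Q' P k - g)" using Suc by (simp add: P_def)
  ultimately have "Fin y < \<nu> ((qcoeff Q' P k - g) + qcoeff Q' (P * e) (Suc k))" by (intro nu_add_gt)
  then show ?case
    using \<open>qcoeff Q' (g * Q ^ Suc k) (Suc k) = _\<close> by (simp add: algebra_simps)
qed

lemma degQ_coeffE:
  assumes Q: "Q \<in> Psi \<nu> m" and f: "f \<noteq> 0"
  obtains y where "degQ \<nu> Q f \<le> degree f"
    "\<nu> (qcoeff Q f (degQ \<nu> Q f)) = Fin y" "nuQ \<nu> Q f = Fin (y + nmul (degQ \<nu> Q f) (gam Q))"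
    "\<And>i. degQ \<nu> Q f < i \<Longrightarrow> i \<le> degree f \<Longrightarrow>
       Fin (y + nmul (degQ \<nu> Q f) (gam Q)) < \<nu> (qcoeff Q f i) + Fin (nmul i (gam Q))"
proof -
  define d where "d = degQ \<nu> Q f"
  have term_eq: "\<nu> (qcoeff Q f i * Q ^ i) = \<nu> (qcoeff Q f i) + Fin (nmul i (gam Q))" for i
    by (simp add: nu_mult nu_power nu_gam[OF Q] nmul_Fin)
  have fin: "finite (SQ \<nu> Q f)" by (simp add: SQ_def)
  have "nuQ \<nu> Q f \<in> (\<lambda>i. \<nu> (qcoeff Q f i * Q ^ i)) ` {0..degree f}"
    unfolding nuQ_def by (intro Min_in) auto
  then have "SQ \<nu> Q f \<noteq> {}" by (auto simp: SQ_def)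
  then have "d \<in> SQ \<nu> Q f" unfolding d_def degQ_def using fin by (rule Max_in[rotated])
  then have d: "d \<le> degree f" "\<nu> (qcoeff Q f d) + Fin (nmul d (gam Q)) = nuQ \<nu> Q f"
    using term_eq[of d] by (auto simp: SQ_def)
  obtain x where x: "nuQ \<nu> Q f = Fin x" by (rule nuQ_finite[OF Q f])
  obtain y where y: "\<nu> (qcoeff Q f d) = Fin y" using d(2) x by (cases "\<nu> (qcoeff Q f d)") auto
  have gt: "nuQ \<nu> Q f < \<nu> (qcoeff Q f i) + Fin (nmul i (gam Q))" if "d < i" "i \<le> degree f" for i
  proof -
    have "i \<notin> SQ \<nu> Q f" using that fin unfolding d_def degQ_def by (meson Max_ge not_le)
    then have "\<nu> (qcoeff Q f i * Q ^ i) \<noteq> nuQ \<nu> Q f" using that by (simp add: SQ_def)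
    moreover have "nuQ \<nu> Q f \<le> \<nu> (qcoeff Q f i * Q ^ i)"
      unfolding nuQ_def using that by (intro Min_le) auto
    ultimately show ?thesis unfolding term_eq by simp
  qed
  show ?thesis
    by (rule that[of y]) (use d y gt in \<open>auto simp: d_def[symmetric]\<close>)
qed

text \<open>In the expansion by \<open>Q'\<close>, terms of index below \<open>degQ\<close> have too
  small a degree to contribute. Those above it have strictly larger weighted value, which
  \<open>wge_term_Psi\<close> preserves. The term of index \<open>degQ\<close> keeps its coefficient
  up to larger value.\<close>

lemma top_coeff_constant:
  assumes Q: "Q \<in> Psi \<nu> m" and Q': "Q' \<in> Psi \<nu> m" and le: "gam Q \<le> gam Q'" and f: "f \<noteq> 0"
  shows "\<nu> (qcoeff Q' f (degQ \<nu> Q f)) = \<nu> (qcoeff Q f (degQ \<nu> Q f))"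
proof -
  define d where "d = degQ \<nu> Q f"
  obtain y where d: "d \<le> degree f" and y: "\<nu> (qcoeff Q f d) = Fin y"
    and gt: "\<And>i. d < i \<Longrightarrow> i \<le> degree f \<Longrightarrow>
      Fin (y + nmul d (gam Q)) < \<nu> (qcoeff Q f i) + Fin (nmul i (gam Q))"
    using degQ_coeffE[OF Q f] unfolding d_def by metis
  have deg: "degree Q = m" "degree Q' = m" using Psi_degree Q Q' by auto
  have deg1: "1 \<le> degree Q" using deg m_pos by simp
  have small: "degree (qcoeff Q f i) < m" for i using degree_qcoeff[OF deg1] deg by simp
  have terms: "Fin y < \<nu> (qcoeff Q' (qcoeff Q f i * Q ^ i) d)" if i: "i \<in> {..degree f} - {d}" for i
  proof (cases "i < d")
    case True
    have "degree (qcoeff Q f i * Q ^ i) \<le> degree (qcoeff Q f i) + degree (Q ^ i)"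
      by (rule degree_mult_le)
    also have "\<dots> < Suc i * m"
      using small[of i] Psi_nonzero[OF Q] deg by (simp add: degree_power_eq)
    also have "\<dots> \<le> d * degree Q'" unfolding deg using True by (intro mult_le_mono1) simp
    finally have "qcoeff Q' (qcoeff Q f i * Q ^ i) d = 0" by (rule qcoeff_eq_0)
    then show ?thesis by simp
  next
    case False
    then have i: "d < i" "i \<le> degree f" using i by auto
    show ?thesis
    proof (cases "\<nu> (qcoeff Q f i)")
      case (Fin z)
      have lt: "y + nmul d (gam Q) < z + nmul i (gam Q)" using gt[OF i] Fin by simp
      have "wge Q' (gam Q) (z + nmul i (gam Q)) (qcoeff Q f i * Q ^ i)"
        using Fin by (intro wge_term_Psi[OF Q Q' le small]) simp
      then have "Fin (z + nmul i (gam Q) - nmul d (gam Q)) \<le> \<nu> (qcoeff Q' (qcoeff Q f i * Q ^ i) d)"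
        by (simp add: wge_def)
      moreover have "Fin y < Fin (z + nmul i (gam Q) - nmul d (gam Q))" using lt by (simp add: algebra_simps)
      ultimately show ?thesis by (rule order.strict_trans2[rotated])
    next
      case Pinf
      have "qcoeff Q f i = 0"
      proof (rule ccontr)
        assume "qcoeff Q f i \<noteq> 0"
        then obtain z where "\<nu> (qcoeff Q f i) = Fin z"
          by (rule finite_value) (use small[of i] in simp)
        then show False using Pinf by simp
      qed
      then show ?thesis by (simp add: qcoeff_0)
    qed (use nu_Minf in auto)
  qed
  have "qcoeff Q' f d = (\<Sum>i\<le>degree f. qcoeff Q' (qcoeff Q f i * Q ^ i) d)"
    unfolding qcoeff_sum[symmetric] by (rule arg_cong[where f = "\<lambda>p. qcoeff Q' p d", OF qexpansion[OF deg1]])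
  also have "\<dots> = qcoeff Q' (qcoeff Q f d * Q ^ d) d
      + (\<Sum>i\<in>{..degree f} - {d}. qcoeff Q' (qcoeff Q f i * Q ^ i) d)"
    using d by (intro sum.remove) auto
  also have "\<dots> = qcoeff Q f d + ((qcoeff Q' (qcoeff Q f d * Q ^ d) d - qcoeff Q f d)
      + (\<Sum>i\<in>{..degree f} - {d}. qcoeff Q' (qcoeff Q f i * Q ^ i) d))" by simp
  finally have eq: "qcoeff Q' f d = \<dots>" .
  have "\<nu> (qcoeff Q f d) < \<nu> ((qcoeff Q' (qcoeff Q f d * Q ^ d) d - qcoeff Q f d)
      + (\<Sum>i\<in>{..degree f} - {d}. qcoeff Q' (qcoeff Q f i * Q ^ i) d))"
    unfolding y using terms y by (intro nu_add_gt nu_sum_gt qcoeff_term_top[OF Q Q' le small]) auto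
  then have "\<nu> (qcoeff Q' f d) = \<nu> (qcoeff Q f d)" unfolding eq by (rule nu_add_eq)
  then show ?thesis by (simp add: d_def)
qed

text \<open>The constant term strictly dominates the rest. For an unstable \<open>F\<close> this
  rules out defect \<open>0\<close>.\<close>

lemma nuQ_eq_nu_if_degQ_0:
  assumes Q: "Q \<in> Psi \<nu> m" and f: "f \<noteq> 0" and d: "degQ \<nu> Q f = 0"
  shows "nuQ \<nu> Q f = \<nu> f"
proof -
  obtain y where y: "\<nu> (qcoeff Q f 0) = Fin y" "nuQ \<nu> Q f = Fin y"
    and gt: "\<And>i. 0 < i \<Longrightarrow> i \<le> degree f \<Longrightarrow> Fin y < \<nu> (qcoeff Q f i) + Fin (nmul i (gam Q))"
    using degQ_coeffE[OF Q f] d by auto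
  have deg1: "1 \<le> degree Q" using Psi_degree[OF Q] m_pos by simp
  have "Fin y < \<nu> (\<Sum>i\<in>{..degree f} - {0}. qcoeff Q f i * Q ^ i)"
    using gt by (intro nu_sum_gt) (auto simp: nu_mult nu_power nu_gam[OF Q] nmul_Fin)
  then have "\<nu> (qcoeff Q f 0 * Q ^ 0 + (\<Sum>i\<in>{..degree f} - {0}. qcoeff Q f i * Q ^ i)) = Fin y"
    using y by (subst nu_add_eq) auto
  moreover have "f = qcoeff Q f 0 * Q ^ 0 + (\<Sum>i\<in>{..degree f} - {0}. qcoeff Q f i * Q ^ i)"
    by (rule trans[OF qexpansion[OF deg1] sum.remove]) auto
  ultimately have "\<nu> f = Fin y" by (rule ssubst[where P = "\<lambda>p. \<nu> p = Fin y", rotated])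
  then show ?thesis using y by simp
qed

end

section \<open>The coefficients of a limit key polynomial\<close>

text \<open>\<open>Q0\<close> starts a final segment on which \<open>degQ\<close> of
  \<open>F\<close> has reached its ultimate value. The point \<open>x\<close> comes from
  \<open>not_vert_boundedE\<close>, so \<open>unbounded\<close> makes the distances
  \<open>gam Q - x\<close> cofinal in a convex subgroup.\<close>

locale limit_data = key_val \<nu> m
  for \<nu> :: "'k::field poly \<Rightarrow> 'g::linordered_ab_group_add extended" and m +
  fixes Qs :: "'k poly set" and F :: "'k poly" and d :: nat and \<beta> x :: 'g and Q0 :: "'k poly"
  assumes Qs_sub: "Qs \<subseteq> Psi \<nu> m"
    and Qs_nomax: "Q \<in> Qs \<Longrightarrow> \<exists>Q'\<in>Qs. gam Q < gam Q'"
    and F_min: "lead_coeff g = 1 \<Longrightarrow> degree g < degree F \<Longrightarrow> Qstable \<nu> Qs g"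
    and F_deg: "m \<le> degree F"
    and Q0: "Q0 \<in> Qs" "x \<le> gam Q0"
    and unbounded: "Q \<in> Qs \<Longrightarrow> x \<le> gam Q \<Longrightarrow> \<exists>Q'\<in>Qs. nmul n (gam Q - x) \<le> gam Q' - x"
    and beta: "Q \<in> Qs \<Longrightarrow> gam Q0 \<le> gam Q \<Longrightarrow> \<nu> (qcoeff Q F d) = Fin \<beta>"
    and nuQ_F: "Q \<in> Qs \<Longrightarrow> gam Q0 \<le> gam Q \<Longrightarrow> nuQ \<nu> Q F = Fin (\<beta> + nmul d (gam Q))"
    and d_pos: "1 \<le> d"
    and d_le: "d \<le> Dnum F m"
begin

lemma Psi: "Q \<in> Qs \<Longrightarrow> Q \<in> Psi \<nu> m"
  using Qs_sub by blast

lemma nu_Q: "Q \<in> Qs \<Longrightarrow> \<nu> Q = Fin (gam Q)"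
  using nu_gam Psi by blast

lemma ev_large_iff: "ev_large Qs \<nu> P \<longleftrightarrow> (\<exists>Q1\<in>Qs. \<forall>Q\<in>Qs. gam Q1 \<le> gam Q \<longrightarrow> P Q)"
  unfolding ev_large_def by (auto simp: nu_Q)

lemma upper:
  assumes "Q1 \<in> Qs" "Q2 \<in> Qs"
  obtains Q where "Q \<in> Qs" "gam Q1 \<le> gam Q" "gam Q2 \<le> gam Q"
  using assms by (metis linear)

lemma ev_largeI:
  assumes "Q1 \<in> Qs" "\<And>Q. Q \<in> Qs \<Longrightarrow> gam Q0 \<le> gam Q \<Longrightarrow> gam Q1 \<le> gam Q \<Longrightarrow> P Q"
  shows "ev_large Qs \<nu> P"
proof -
  obtain Q2 where "Q2 \<in> Qs" "gam Q0 \<le> gam Q2" "gam Q1 \<le> gam Q2" using upper Q0(1) assms(1) by blast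
  then show ?thesis unfolding ev_large_iff using assms(2) by (metis order.trans)
qed

lemma ev_largeE:
  assumes "ev_large Qs \<nu> P" "Q2 \<in> Qs"
  obtains Q where "Q \<in> Qs" "gam Q0 \<le> gam Q" "gam Q2 \<le> gam Q" "P Q"
proof -
  obtain Q1 where Q1: "Q1 \<in> Qs" "\<forall>Q\<in>Qs. gam Q1 \<le> gam Q \<longrightarrow> P Q" using assms(1) by (auto simp: ev_large_iff)
  obtain Q3 where "Q3 \<in> Qs" "gam Q0 \<le> gam Q3" "gam Q1 \<le> gam Q3" using upper Q0(1) Q1(1) by blast
  then obtain Q where "Q \<in> Qs" "gam Q3 \<le> gam Q" "gam Q2 \<le> gam Q" using upper assms(2) by blast
  then show ?thesis using that Q1 \<open>gam Q0 \<le> gam Q3\<close> \<open>gam Q1 \<le> gam Q3\<close> by (metis order.trans)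
qed

lemma small_coeff: "Q \<in> Qs \<Longrightarrow> degree (qcoeff Q f i) < m"
  using degree_qcoeff[of Q f i] Psi_degree[OF Psi] m_pos by simp

lemma coeff_value_in_Gam: "Q \<in> Qs \<Longrightarrow> \<nu> (qcoeff Q f i) = Fin y \<Longrightarrow> y \<in> Gam \<nu>"
  using small_value_in_Gam[OF Psi small_coeff] by blast

lemma gam_Gam: "Q \<in> Qs \<Longrightarrow> gam Q \<in> Gam \<nu>"
  using gam_in_Gam Psi by blast

lemma beta_Gam: "\<beta> \<in> Gam \<nu>"
  using coeff_value_in_Gam[OF Q0(1) beta[OF Q0(1)]] by simp

text \<open>Truncated values grow with \<open>Q\<close> by \<open>nuQ_mono\<close>, so the members
  beyond \<open>Q0\<close>, where they have an explicit form, generate the same initial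
  segment.\<close>

lemma deltaL_iff:
  "y \<in> deltaL \<nu> Qs F \<longleftrightarrow> y \<in> Gam \<nu> \<and> (\<exists>Q\<in>Qs. gam Q0 \<le> gam Q \<and> y \<le> \<beta> + nmul d (gam Q))"
proof
  assume "y \<in> deltaL \<nu> Qs F"
  then obtain Q where Q: "y \<in> Gam \<nu>" "Q \<in> Qs" "Fin y \<le> nuQ \<nu> Q F" by (auto simp: deltaL_def)
  obtain Q' where Q': "Q' \<in> Qs" "gam Q0 \<le> gam Q'" "gam Q \<le> gam Q'" using upper Q0(1) Q(2) by blast
  have "Fin y \<le> nuQ \<nu> Q' F"
    using Q(3) nuQ_mono[OF Psi[OF Q(2)] Psi[OF Q'(1)] Q'(3)] by (rule order.trans)
  then have "y \<le> \<beta> + nmul d (gam Q')" using nuQ_F[OF Q'(1,2)] by simp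
  then show "y \<in> Gam \<nu> \<and> (\<exists>Q\<in>Qs. gam Q0 \<le> gam Q \<and> y \<le> \<beta> + nmul d (gam Q))" using Q Q' by auto
next
  assume "y \<in> Gam \<nu> \<and> (\<exists>Q\<in>Qs. gam Q0 \<le> gam Q \<and> y \<le> \<beta> + nmul d (gam Q))"
  then show "y \<in> deltaL \<nu> Qs F" unfolding deltaL_def using nuQ_F by force
qed

lemma betaQ_ge:
  assumes Q: "Q \<in> Qs" "gam Q0 \<le> gam Q" and l: "l \<le> d"
  shows "Fin (\<beta> + nmul (d - l) (gam Q)) \<le> betaQ \<nu> F Q l"
proof -
  have "wge Q (gam Q) (\<beta> + nmul d (gam Q)) F"
    using nuQ_F[OF Q] nuQ_ge_iff[OF Psi[OF Q(1)], of "\<beta> + nmul d (gam Q)" F] by simp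
  then show ?thesis using l by (simp add: wge_def betaQ_def nmul_diff_left algebra_simps)
qed

lemma term_value: "Q \<in> Qs \<Longrightarrow> betaQ \<nu> F Q l + nmul l (\<nu> Q) = \<nu> (qcoeff Q F l) + Fin (nmul l (gam Q))"
  by (simp add: betaQ_def nu_Q nmul_Fin)

section \<open>The index \<open>d\<close> itself\<close>

text \<open>The term of index \<open>d\<close> attains the truncated value of \<open>F\<close>,
  which lies in \<open>deltaL\<close>.\<close>

lemma d_in_Bct: "d \<in> Bct \<nu> Qs m F"
proof -
  have "d \<notin> Jset \<nu> Qs m F"
  proof
    assume "d \<in> Jset \<nu> Qs m F"
    then have ev: "ev_large Qs \<nu> (\<lambda>Q. above_delta \<nu> Qs F (betaQ \<nu> F Q d + nmul d (\<nu> Q)))"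
      by (simp add: Jset_def)
    obtain Q where Q: "Q \<in> Qs" "gam Q0 \<le> gam Q"
      "above_delta \<nu> Qs F (betaQ \<nu> F Q d + nmul d (\<nu> Q))"
      using ev Q0(1) by (rule ev_largeE)
    have "betaQ \<nu> F Q d + nmul d (\<nu> Q) = Fin (\<beta> + nmul d (gam Q))"
      using Q by (simp add: term_value beta)
    then have "\<beta> + nmul d (gam Q) \<in> Gam \<nu> \<and> \<beta> + nmul d (gam Q) \<notin> deltaL \<nu> Qs F"
      using Q(3) by (simp add: above_delta_def)
    then show False using Q by (auto simp: deltaL_iff)
  qed
  then have "d \<in> Bset \<nu> Qs m F" using d_le by (simp add: Bset_def)
  moreover have "ev_large Qs \<nu> (\<lambda>Q. betaQ \<nu> F Q d = Fin \<beta>)"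
    using Q0(1) by (rule ev_largeI) (simp add: betaQ_def beta)
  ultimately show ?thesis by (auto simp: Bct_def)
qed

text \<open>The coefficient value stays at \<beta>. Since \<open>d\<close> is positive, replacing
  \<open>Q0\<close> by a later \<open>Q'\<close> leaves room for \<beta> plus the gap
  \<open>h\<close> in \<open>calB\<close>.\<close>

lemma d_notin_Bunb: "d \<notin> Bunb \<nu> Qs m F"
proof
  assume d: "d \<in> Bunb \<nu> Qs m F"
  obtain Q' where Q': "Q' \<in> Qs" "gam Q0 < gam Q'" using Qs_nomax[OF Q0(1)] by blast
  define h where "h = gam Q' - gam Q0"
  have h: "0 < h" using Q' by (simp add: h_def)
  have hG: "h \<in> Gam \<nu>" unfolding h_def by (intro Gam_diff gam_Gam Q' Q0)
  have "nmul 1 h \<le> nmul d h" using h d_pos by (intro nmul_mono_left) auto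
  then have le: "\<beta> + h + nmul d (gam Q0) \<le> \<beta> + nmul d (gam Q')"
    by (simp add: h_def nmul_diff_right algebra_simps)
  have "\<beta> + h + nmul d (gam Q0) \<in> deltaL \<nu> Qs F"
    unfolding deltaL_iff using le Q'
    by (intro conjI bexI[of _ Q'] Gam_add Gam_nmul gam_Gam beta_Gam hG Q0) auto
  then have "Fin (\<beta> + h) + nmul d (\<nu> Q0) \<in> Fin ` deltaL \<nu> Qs F"
    by (simp add: nu_Q[OF Q0(1)] nmul_Fin)
  then have "\<beta> + h \<in> calB \<nu> Qs F d"
    unfolding calB_def using Gam_add[OF beta_Gam hG] Q0(1) by blast
  then have ev: "ev_large Qs \<nu> (\<lambda>Q. Fin (\<beta> + h) \<le> betaQ \<nu> F Q d)" using d by (simp add: Bunb_def)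
  obtain Q where "Q \<in> Qs" "gam Q0 \<le> gam Q" "Fin (\<beta> + h) \<le> betaQ \<nu> F Q d"
    using ev Q0(1) by (rule ev_largeE)
  then show False using h by (simp add: betaQ_def beta)
qed

section \<open>Coefficients of index below \<open>d\<close>\<close>

text \<open>Collects the bounds of \<open>betaQ_ge\<close> for all \<open>Q\<close> at once, whereas
  a coefficient is a priori only known to satisfy the one for its own \<open>Q\<close>.\<close>

definition big :: "nat \<Rightarrow> 'g extended \<Rightarrow> bool" where
  "big l y \<longleftrightarrow> (\<forall>Q\<in>Qs. Fin (\<beta> + nmul (d - l) (gam Q)) \<le> y)"

lemma bigI:
  assumes "Q1 \<in> Qs"
    "\<And>Q. Q \<in> Qs \<Longrightarrow> gam Q0 \<le> gam Q \<Longrightarrow> gam Q1 \<le> gam Q \<Longrightarrow> Fin (\<beta> + nmul (d - l) (gam Q)) \<le> y"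
  shows "big l y"
  unfolding big_def
proof
  fix Q assume Q: "Q \<in> Qs"
  obtain Q2 where Q2: "Q2 \<in> Qs" "gam Q0 \<le> gam Q2" "gam Q1 \<le> gam Q2" using upper Q0(1) assms(1) by blast
  obtain Q3 where Q3: "Q3 \<in> Qs" "gam Q2 \<le> gam Q3" "gam Q \<le> gam Q3" using upper Q2(1) Q by blast
  have "Fin (\<beta> + nmul (d - l) (gam Q)) \<le> Fin (\<beta> + nmul (d - l) (gam Q3))"
    using nmul_mono[OF Q3(3)] by simp
  also have "\<dots> \<le> y" using Q2 Q3 by (intro assms(2)) auto
  finally show "Fin (\<beta> + nmul (d - l) (gam Q)) \<le> y" .
qed

lemma nmul_shift: "l \<le> d \<Longrightarrow> nmul d x = nmul (d - l) x + nmul l x"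
  using nmul_add_left[of "d - l" l x] by simp

lemma nmul_gam: "nmul n (gam Q) = nmul n (gam Q - x) + nmul n x"
  by (simp add: nmul_diff_right)

text \<open>Otherwise \<open>l\<close> would lie in \<open>Jset\<close>: as \<open>d - l\<close> is
  positive, \<open>(d - l) (gam Q4 - x)\<close> exceeds any given \<open>d (gam Q2 - x)\<close> for
  suitable \<open>Q4\<close>, so the terms of index \<open>l\<close> exceed all of
  \<open>deltaL\<close>.\<close>

lemma not_eventually_big:
  assumes l: "l \<in> Bset \<nu> Qs m F" "l < d"
  shows "\<not> ev_large Qs \<nu> (\<lambda>Q. big l (betaQ \<nu> F Q l))"
proof
  assume "ev_large Qs \<nu> (\<lambda>Q. big l (betaQ \<nu> F Q l))"
  then obtain Q1 where Q1: "Q1 \<in> Qs" "\<And>Q. Q \<in> Qs \<Longrightarrow> gam Q1 \<le> gam Q \<Longrightarrow> big l (betaQ \<nu> F Q l)"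
    by (auto simp: ev_large_iff)
  have "ev_large Qs \<nu> (\<lambda>Q. above_delta \<nu> Qs F (betaQ \<nu> F Q l + nmul l (\<nu> Q)))"
  proof (rule ev_largeI[OF Q1(1)])
    fix Q assume Q: "Q \<in> Qs" "gam Q0 \<le> gam Q" "gam Q1 \<le> gam Q"
    have big: "big l (\<nu> (qcoeff Q F l))" using Q1(2)[OF Q(1,3)] by (simp add: betaQ_def)
    show "above_delta \<nu> Qs F (betaQ \<nu> F Q l + nmul l (\<nu> Q))"
    proof (cases "\<nu> (qcoeff Q F l)")
      case (Fin y)
      have "y + nmul l (gam Q) \<notin> deltaL \<nu> Qs F"
      proof
        assume "y + nmul l (gam Q) \<in> deltaL \<nu> Qs F"
        then obtain Q2 where Q2: "Q2 \<in> Qs" "gam Q0 \<le> gam Q2" "y + nmul l (gam Q) \<le> \<beta> + nmul d (gam Q2)"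
          by (auto simp: deltaL_iff)
        obtain Q3 where Q3: "Q3 \<in> Qs" "nmul d (gam Q2 - x) \<le> gam Q3 - x"
          using unbounded[OF Q2(1), of d] Q2(2) Q0(2) by fastforce
        \<comment> \<open>\<open>unbounded\<close> gives a weak inequality; a later member makes it
          strict.\<close>
        obtain Q4 where Q4: "Q4 \<in> Qs" "gam Q3 < gam Q4" using Qs_nomax[OF Q3(1)] by blast
        have "0 \<le> gam Q2 - x" using Q2(2) Q0(2) by simp
        then have "0 \<le> gam Q3 - x" using Q3(2) nmul_nonneg order.trans by blast
        then have pos: "0 \<le> gam Q4 - x" using Q4(2) by simp
        have "nmul d (gam Q2 - x) < gam Q4 - x" using Q3(2) Q4(2) by (simp add: algebra_simps)
        also have "\<dots> \<le> nmul (d - l) (gam Q4 - x)"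
          using nmul_mono_left[of 1 "d - l" "gam Q4 - x"] pos l by simp
        also have "\<dots> \<le> nmul (d - l) (gam Q4 - x) + nmul l (gam Q - x)"
          using nmul_nonneg[of "gam Q - x" l] Q(2) Q0(2) by simp
        finally have "\<beta> + nmul d (gam Q2) < \<beta> + nmul (d - l) (gam Q4) + nmul l (gam Q)"
          unfolding nmul_gam[of d] nmul_gam[of "d - l"] nmul_gam[of l] nmul_shift[OF less_imp_le[OF l(2)]]
          by (simp add: ac_simps)
        also have "\<dots> \<le> y + nmul l (gam Q)" using big Q4(1) Fin by (auto simp: big_def)
        finally show False using Q2(3) by simp
      qed
      moreover have "y + nmul l (gam Q) \<in> Gam \<nu>"
        by (intro Gam_add Gam_nmul gam_Gam Q coeff_value_in_Gam[OF Q(1) Fin])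
      ultimately show ?thesis using Q Fin by (simp add: above_delta_def term_value)
    qed (use Q nu_Minf in \<open>auto simp: above_delta_def term_value\<close>)
  qed
  then show False using l by (auto simp: Bset_def Jset_def)
qed

text \<open>A constant value would dominate the lower bounds for all large \<open>Q\<close>, hence
  be big.\<close>

lemma notin_Bct:
  assumes "l < d"
  shows "l \<notin> Bct \<nu> Qs m F"
proof
  assume l: "l \<in> Bct \<nu> Qs m F"
  then obtain c Q1 where Q1: "Q1 \<in> Qs" "\<And>Q. Q \<in> Qs \<Longrightarrow> gam Q1 \<le> gam Q \<Longrightarrow> betaQ \<nu> F Q l = c"
    by (auto simp: Bct_def ev_large_iff)
  have "big l c"
    using Q1 betaQ_ge[of _ l] assms by (intro bigI[OF Q1(1)]) fastforce
  then have "ev_large Qs \<nu> (\<lambda>Q. big l (betaQ \<nu> F Q l))"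
    using Q1 by (auto simp: ev_large_iff)
  then show False using not_eventually_big l assms by (auto simp: Bct_def)
qed

text \<open>The remaining case: some \<open>gam Q1\<close> lies below \<open>x\<close> by more than every \<open>gam Q - x\<close>. Up to
  big terms, the coefficient of index \<open>l \<ge> 1\<close> is then the residue of the formal derivative of
  order \<open>l\<close> of \<open>F\<close> with respect to \<open>Q0\<close>, which is stable by minimality of \<open>degree F\<close>.\<close>

definition qderiv :: "nat \<Rightarrow> 'k poly" where
  "qderiv l = (\<Sum>i\<in>{l..degree F}. of_nat (i choose l) * (qcoeff Q0 F i * Q0 ^ (i - l)))"

text \<open>As \<open>l\<close> is positive, every term loses at least one factor
  \<open>Q0\<close>.\<close>

lemma degree_qderiv:
  assumes "1 \<le> l"
  shows "degree (qderiv l) < degree F"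
proof -
  have deg: "degree Q0 = m" using Psi_degree[OF Psi[OF Q0(1)]] .
  have "degree (of_nat (i choose l) * (qcoeff Q0 F i * Q0 ^ (i - l))) \<le> degree F - m"
    if i: "i \<in> {l..degree F}" for i
  proof (cases "qcoeff Q0 F i = 0")
    case False
    have "degree (of_nat (i choose l) * (qcoeff Q0 F i * Q0 ^ (i - l)))
        \<le> degree (of_nat (i choose l) :: 'k poly) + degree (qcoeff Q0 F i * Q0 ^ (i - l))"
      by (rule degree_mult_le)
    also have "\<dots> = degree (qcoeff Q0 F i * Q0 ^ (i - l))" by simp
    also have "\<dots> = degree (qcoeff Q0 F i) + (i - l) * m"
      using False Psi_nonzero[OF Psi[OF Q0(1)]] deg by (simp add: degree_mult_eq degree_power_eq)
    also have "\<dots> \<le> degree F - m"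
    proof -
      have "degree (qcoeff Q0 F i) + i * m \<le> degree F"
        using degree_qcoeff_bound[OF False] deg m_pos by simp
      moreover have "(i - l) * m + m \<le> i * m"
      proof -
        have "(i - l) * m + m = Suc (i - l) * m" by simp
        also have "\<dots> \<le> i * m" using i assms by (intro mult_le_mono1) auto
        finally show ?thesis .
      qed
      ultimately show ?thesis by linarith
    qed
    finally show ?thesis .
  qed simp
  then have "degree (qderiv l) \<le> degree F - m"
    unfolding qderiv_def by (intro degree_sum_le) auto
  then show ?thesis using F_deg m_pos by linarith
qed

text \<open>After scaling, \<open>G\<close> is monic and stable by minimality of
  \<open>degree F\<close>. Once the truncation at \<open>Q1\<close> gives its value, expanding in a
  strictly later \<open>Q\<close> with the old weight \<open>gam Q1\<close> makes all terms of
  positive index strictly larger, so the residue carries the value.\<close>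

lemma stable_mod:
  assumes G: "G \<noteq> 0" "degree G < degree F"
  obtains c Q1 where "Q1 \<in> Qs" "\<And>Q. Q \<in> Qs \<Longrightarrow> gam Q1 \<le> gam Q \<Longrightarrow> \<nu> (G mod Q) = Fin c"
proof -
  define u where "u = lead_coeff G"
  define H where "H = smult (inverse u) G"
  have u: "u \<noteq> 0" using G by (simp add: u_def)
  have H: "H \<noteq> 0" "lead_coeff H = 1" "degree H < degree F" and GH: "G = smult u H"
    using u G by (auto simp: H_def u_def)
  have ev: "ev_large Qs \<nu> (\<lambda>Q. nuQ \<nu> Q H = \<nu> H)" using F_min[OF H(2,3)] by (simp add: Qstable_def)
  obtain Q1 where Q1: "Q1 \<in> Qs" "nuQ \<nu> Q1 H = \<nu> H" using ev Q0(1) by (rule ev_largeE)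
  obtain c where c: "nuQ \<nu> Q1 H = Fin c" by (rule nuQ_finite[OF Psi[OF Q1(1)] H(1)])
  obtain Q2 where Q2: "Q2 \<in> Qs" "gam Q1 < gam Q2" using Qs_nomax[OF Q1(1)] by blast
  have HQ: "\<nu> (H mod Q) = Fin c" if Q: "Q \<in> Qs" "gam Q2 \<le> gam Q" for Q
  proof -
    have lt: "gam Q1 < gam Q" using Q Q2 by simp
    have deg1: "1 \<le> degree Q" using Psi_degree[OF Psi[OF Q(1)]] m_pos by simp
    have "wge Q (gam Q1) c H"
      using c nuQ_ge_iff[OF Psi[OF Q1(1)], of c H] lt
      by (intro wge_change_Q[OF Psi[OF Q1(1)] Psi[OF Q(1)]]) auto
    then have w: "Fin (c - nmul j (gam Q1)) \<le> \<nu> (qcoeff Q H j)" for j by (simp add: wge_def)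
    have "Fin c < \<nu> (\<Sum>j\<in>{..degree H} - {0}. qcoeff Q H j * Q ^ j)"
    proof (rule nu_sum_gt)
      fix j assume "j \<in> {..degree H} - {0}"
      then have "nmul j (gam Q1) < nmul j (gam Q)" using lt by (intro nmul_strict_mono) auto
      then have "Fin c < Fin (c - nmul j (gam Q1) + nmul j (gam Q))" by (simp add: algebra_simps)
      also have "\<dots> \<le> \<nu> (qcoeff Q H j * Q ^ j)"
        by (rule nu_mult_ge[OF w]) (simp add: nu_power nu_Q[OF Q(1)] nmul_Fin)
      finally show "Fin c < \<nu> (qcoeff Q H j * Q ^ j)" .
    qed
    then have gt: "\<nu> H < \<nu> (- (\<Sum>j\<in>{..degree H} - {0}. qcoeff Q H j * Q ^ j))" using c Q1(2) by simp
    have "H = qcoeff Q H 0 * Q ^ 0 + (\<Sum>j\<in>{..degree H} - {0}. qcoeff Q H j * Q ^ j)"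
      by (rule trans[OF qexpansion[OF deg1] sum.remove]) auto
    then have "H - (\<Sum>j\<in>{..degree H} - {0}. qcoeff Q H j * Q ^ j) = qcoeff Q H 0 * Q ^ 0"
      by (simp only: diff_eq_eq)
    then have "H mod Q = H + - (\<Sum>j\<in>{..degree H} - {0}. qcoeff Q H j * Q ^ j)" by simp
    then show ?thesis using nu_add_eq[OF gt] c Q1(2) by simp
  qed
  obtain v where v: "\<nu> [:u:] = Fin v" by (rule finite_value[of "[:u:]"]) (use u in auto)
  show ?thesis
  proof (rule that[OF Q2(1)])
    fix Q assume Q: "Q \<in> Qs" "gam Q2 \<le> gam Q"
    have "G mod Q = [:u:] * (H mod Q)" by (simp add: GH mod_smult_left)
    then have "\<nu> (G mod Q) = \<nu> [:u:] + \<nu> (H mod Q)" by (simp only: nu_mult)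
    then show "\<nu> (G mod Q) = Fin (v + c)" using HQ[OF Q] v by simp
  qed
qed

text \<open>Binomial expansion of \<open>Q0 = Q + e\<close>: terms starting at \<open>Q ^ l\<close>
  give the residue of \<open>qderiv l\<close>, and those from \<open>j < l\<close> must be carried
  \<open>l - j\<close> places. With weight \<open>gam Q1\<close> the latter have value at least
  \<beta> plus \<open>(d - l) gam Q0 + (l - j) (gam Q0 - gam Q1)\<close>, where the last summand
  outweighs all multiples of distances \<open>gam Q - x\<close>.\<close>

lemma coeff_minus_qderiv_big:
  assumes l: "l < d" and Q1: "Q1 \<in> Qs"
    and far: "\<And>Q. Q \<in> Qs \<Longrightarrow> gam Q - x < x - gam Q1"
    and Q: "Q \<in> Qs" "gam Q0 \<le> gam Q"
  shows "big l (\<nu> (qcoeff Q F l - qderiv l mod Q))"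
proof (rule bigI[OF Q0(1)])
  fix Q3 assume Q3: "Q3 \<in> Qs" "gam Q0 \<le> gam Q3"
  define e where "e = Q0 - Q"
  define g where "g i = qcoeff Q0 F i" for i
  \<comment> \<open>The factor of \<open>Q ^ j\<close> in \<open>g i * (Q + e) ^ i\<close>, not yet
    reduced modulo \<open>Q\<close>.\<close>
  define P where "P i j = of_nat (i choose j) * (g i * e ^ (i - j))" for i j
  have deg: "degree Q = m" "degree Q0 = m" using Psi_degree Psi Q Q0 by auto
  have deg1: "1 \<le> degree Q" "1 \<le> degree Q0" using deg m_pos by auto
  have "0 \<le> gam Q0 - x" using Q0 by simp
  also have "gam Q0 - x < x - gam Q1" by (rule far[OF Q0(1)])
  finally have Q1x: "gam Q1 < x" by simp
  then have le: "gam Q1 \<le> gam Q" using Q0 Q by simp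
  have c: "compat Q (gam Q1)" by (rule compat_Psi[OF Psi[OF Q1] Psi[OF Q(1)] le])
  have we: "wge Q (gam Q1) (gam Q0) e"
  proof (rule wge_small[OF deg(1)])
    show "degree e < m" unfolding e_def by (rule Psi_diff[OF Psi[OF Q(1)] Psi[OF Q0(1)]])
    show "Fin (gam Q0) \<le> \<nu> e"
      unfolding e_def using Q nu_Q[OF Q0(1)] nu_Q[OF Q(1)] by (intro nu_diff_ge) auto
  qed
  have wg: "wge Q (gam Q1) (\<beta> + nmul d (gam Q0) - nmul i (gam Q0)) (g i)" for i
  proof (rule wge_small[OF deg(1)])
    show "degree (g i) < m" unfolding g_def by (rule small_coeff[OF Q0(1)])
    have "wge Q0 (gam Q0) (\<beta> + nmul d (gam Q0)) F"
      using nuQ_F[OF Q0(1)] nuQ_ge_iff[OF Psi[OF Q0(1)], of "\<beta> + nmul d (gam Q0)" F] by simp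
    then show "Fin (\<beta> + nmul d (gam Q0) - nmul i (gam Q0)) \<le> \<nu> (g i)" by (simp add: wge_def g_def)
  qed
  have wP: "wge Q (gam Q1) (\<beta> + nmul d (gam Q0) - nmul j (gam Q0)) (P i j)" if "j \<le> i" for i j
  proof -
    have "wge Q (gam Q1) ((\<beta> + nmul d (gam Q0) - nmul i (gam Q0)) + nmul (i - j) (gam Q0)) (P i j)"
      unfolding P_def by (intro wge_of_nat_mult wge_mult[OF c] wg wge_power[OF c] we)
    then show ?thesis using that by (simp add: nmul_diff_left)
  qed
  have small: "Fin (\<beta> + nmul (d - l) (gam Q3)) \<le> \<nu> (qcoeff Q (P i j) (l - j))" if ij: "j \<le> i" "j < l" for i j
  proof -
    \<comment> \<open>\<open>unbounded\<close> bounds the multiple of a distance by a single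
      distance, to which \<open>far\<close> applies.\<close>
    obtain Q4 where Q4: "Q4 \<in> Qs" "nmul (d - l) (gam Q3 - x) \<le> gam Q4 - x"
      using unbounded[OF Q3(1), of "d - l"] Q3(2) Q0(2) by fastforce
    have "nmul (d - l) (gam Q3 - x) \<le> x - gam Q1" using Q4(2) far[OF Q4(1)] by simp
    also have "\<dots> \<le> gam Q0 - gam Q1" using Q0(2) by simp
    also have "\<dots> \<le> nmul (l - j) (gam Q0 - gam Q1)"
      using nmul_mono_left[of 1 "l - j" "gam Q0 - gam Q1"] ij Q1x Q0(2) by simp
    also have "\<dots> \<le> nmul (d - l) (gam Q0 - x) + nmul (l - j) (gam Q0 - gam Q1)"
      using nmul_nonneg[of "gam Q0 - x" "d - l"] Q0(2) by simp
    finally have "nmul (d - l) (gam Q3) \<le> nmul (d - l) (gam Q0) + nmul (l - j) (gam Q0 - gam Q1)"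
      by (simp add: nmul_diff_right algebra_simps)
    also have "\<dots> = nmul d (gam Q0) - nmul j (gam Q0) - nmul (l - j) (gam Q1)"
      using l ij by (simp add: nmul_diff_right nmul_diff_left algebra_simps)
    finally have "Fin (\<beta> + nmul (d - l) (gam Q3)) \<le> Fin (\<beta> + nmul d (gam Q0) - nmul j (gam Q0) - nmul (l - j) (gam Q1))"
      by (simp add: algebra_simps)
    also have "\<dots> \<le> \<nu> (qcoeff Q (P i j) (l - j))" using wP[OF ij(1)] by (simp add: wge_def)
    finally show ?thesis .
  qed
  have Q0_eq: "Q0 = Q + e" by (simp add: e_def)
  have coeff_eq: "qcoeff Q (g i * Q0 ^ i) l = (\<Sum>j\<le>i. if l < j then 0 else qcoeff Q (P i j) (l - j))" for i
  proof -
    have "g i * Q0 ^ i = (\<Sum>j\<le>i. P i j * Q ^ j)"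
      unfolding Q0_eq binomial_ring sum_distrib_left P_def by (intro sum.cong refl) (simp only: mult_ac)
    then show ?thesis by (simp only: qcoeff_sum qcoeff_mult_power[OF deg1(1)])
  qed
  have F_eq: "qcoeff Q F l = (\<Sum>i\<le>degree F. qcoeff Q (g i * Q0 ^ i) l)"
    unfolding qcoeff_sum[symmetric] g_def
    by (rule arg_cong[where f = "\<lambda>p. qcoeff Q p l", OF qexpansion[OF deg1(2)]])
  \<comment> \<open>Since \<open>Q0\<close> and \<open>e\<close> agree modulo \<open>Q\<close>, the
    terms of \<open>qderiv l\<close> match the \<open>P i l\<close>.\<close>
  have pow_mod: "(h * Q0 ^ k) mod Q = (h * e ^ k) mod Q" for h k
  proof -
    have "Q0 ^ k mod Q = e ^ k mod Q"
      unfolding Q0_eq by (metis mod_add_self1 power_mod)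
    then show ?thesis by (metis mod_mult_right_eq)
  qed
  have "qderiv l mod Q = (\<Sum>i\<in>{l..degree F}. P i l mod Q)"
    unfolding qderiv_def mod_poly_sum P_def g_def mult.assoc[symmetric] pow_mod ..
  also have "\<dots> = (\<Sum>i\<le>degree F. if l \<le> i then P i l mod Q else 0)"
    by (intro sum.mono_neutral_cong_left) auto
  finally have G_eq: "qderiv l mod Q = \<dots>" .
  have "qcoeff Q F l - qderiv l mod Q
      = (\<Sum>i\<le>degree F. qcoeff Q (g i * Q0 ^ i) l - (if l \<le> i then P i l mod Q else 0))"
    unfolding F_eq G_eq by (simp add: sum_subtractf)
  moreover have "qcoeff Q (g i * Q0 ^ i) l - (if l \<le> i then P i l mod Q else 0)
      = (\<Sum>j\<in>{..i} \<inter> {..<l}. qcoeff Q (P i j) (l - j))" for i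
  proof -
    have "(\<Sum>j\<le>i. if l < j then 0 else qcoeff Q (P i j) (l - j))
        = (\<Sum>j\<in>{..i} \<inter> {..l}. qcoeff Q (P i j) (l - j))"
      by (intro sum.mono_neutral_cong_right) auto
    also have "\<dots> = (\<Sum>j\<in>{..i} \<inter> {..<l}. qcoeff Q (P i j) (l - j)) + (if l \<le> i then P i l mod Q else 0)"
    proof (cases "l \<le> i")
      case True
      then have "{..i} \<inter> {..l} = insert l ({..i} \<inter> {..<l})" by auto
      then show ?thesis using True by (simp add: add.commute)
    next
      case False
      then have "{..i} \<inter> {..l} = {..i} \<inter> {..<l}" by auto
      then show ?thesis using False by simp
    qed
    finally show ?thesis unfolding coeff_eq by simp
  qed
  ultimately have "qcoeff Q F l - qderiv l mod Q
      = (\<Sum>i\<le>degree F. \<Sum>j\<in>{..i} \<inter> {..<l}. qcoeff Q (P i j) (l - j))" by simp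
  then show "Fin (\<beta> + nmul (d - l) (gam Q3)) \<le> \<nu> (qcoeff Q F l - qderiv l mod Q)"
    using small by (auto intro!: nu_sum_ge)
qed

text \<open>If \<open>qderiv l\<close> vanishes or its residue has big ultimate value, the
  coefficient is eventually big. Otherwise the residue dominates and the coefficient is ultimately
  constant. Both are excluded for indices of \<open>Bset\<close> below \<open>d\<close>.\<close>

lemma far_imp_notin_Bset:
  assumes l: "1 \<le> l" "l < d" and Q1: "Q1 \<in> Qs"
    and far: "\<And>Q. Q \<in> Qs \<Longrightarrow> gam Q - x < x - gam Q1"
  shows "l \<notin> Bset \<nu> Qs m F"
proof
  assume lB: "l \<in> Bset \<nu> Qs m F"
  define G where "G = qderiv l"
  have split: "betaQ \<nu> F Q l = \<nu> (G mod Q + (qcoeff Q F l - G mod Q))" for Q by (simp add: betaQ_def)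
  have bigr: "big l (\<nu> (qcoeff Q F l - G mod Q))" if "Q \<in> Qs" "gam Q0 \<le> gam Q" for Q
    unfolding G_def using coeff_minus_qderiv_big[OF l(2) Q1 far that] .
  have no: "\<not> ev_large Qs \<nu> (\<lambda>Q. big l (betaQ \<nu> F Q l))" by (rule not_eventually_big[OF lB l(2)])
  show False
  proof (cases "G = 0")
    case True
    have "ev_large Qs \<nu> (\<lambda>Q. big l (betaQ \<nu> F Q l))"
      using bigr True by (intro ev_largeI[OF Q0(1)]) (simp add: split)
    then show False using no by simp
  next
    case False
    obtain c Q2 where Q2: "Q2 \<in> Qs" and c: "\<And>Q. Q \<in> Qs \<Longrightarrow> gam Q2 \<le> gam Q \<Longrightarrow> \<nu> (G mod Q) = Fin c"
      using stable_mod[OF False] degree_qderiv[OF l(1)] unfolding G_def by metis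
    show False
    proof (cases "big l (Fin c)")
      case True
      have "ev_large Qs \<nu> (\<lambda>Q. big l (betaQ \<nu> F Q l))"
        using True bigr c unfolding split big_def
        by (intro ev_largeI[OF Q2] ballI nu_add_ge) auto
      then show False using no by simp
    next
      case False
      then obtain Q3 where Q3: "Q3 \<in> Qs" "c < \<beta> + nmul (d - l) (gam Q3)" by (auto simp: big_def)
      have "ev_large Qs \<nu> (\<lambda>Q. betaQ \<nu> F Q l = Fin c)"
      proof (rule ev_largeI[OF Q2])
        fix Q assume Q: "Q \<in> Qs" "gam Q0 \<le> gam Q" "gam Q2 \<le> gam Q"
        have "Fin c < Fin (\<beta> + nmul (d - l) (gam Q3))" using Q3 by simp
        also have "\<dots> \<le> \<nu> (qcoeff Q F l - G mod Q)" using bigr[OF Q(1,2)] Q3(1) by (simp add: big_def)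
        finally have "\<nu> (G mod Q) < \<nu> (qcoeff Q F l - G mod Q)" using c[OF Q(1,3)] by simp
        then show "betaQ \<nu> F Q l = Fin c" unfolding split using c[OF Q(1,3)] by (simp only: nu_add_eq)
      qed
      then have "l \<in> Bct \<nu> Qs m F" using lB by (auto simp: Bct_def)
      then show False using notin_Bct[OF l(2)] by simp
    qed
  qed
qed

text \<open>An element of \<open>calB\<close> is bounded through some \<open>Q1\<close> and
  \<open>Q2\<close>. Measured from \<open>x\<close>, both contributions are absorbed by one later
  distance, hence by the lower bound of \<open>betaQ_ge\<close>.\<close>

lemma in_Bunb:
  assumes l: "l \<in> Bset \<nu> Qs m F" "l < d"
  shows "l \<in> Bunb \<nu> Qs m F"
proof -
  have "ev_large Qs \<nu> (\<lambda>Q. Fin b \<le> betaQ \<nu> F Q l)" if b: "b \<in> calB \<nu> Qs F l" for b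
  proof -
    obtain b' Q1 where b': "b \<le> b'" and Q1: "Q1 \<in> Qs"
      and "Fin b' + nmul l (\<nu> Q1) \<in> Fin ` deltaL \<nu> Qs F"
      using b unfolding calB_def by blast
    then have "b' + nmul l (gam Q1) \<in> deltaL \<nu> Qs F" by (auto simp: nu_Q nmul_Fin)
    then obtain Q2 where Q2: "Q2 \<in> Qs" "gam Q0 \<le> gam Q2" "b' + nmul l (gam Q1) \<le> \<beta> + nmul d (gam Q2)"
      by (auto simp: deltaL_iff)
    \<comment> \<open>For \<open>l = 0\<close> the last inequality is trivial. Otherwise a
      \<open>Q1\<close> too far below \<open>x\<close> would contradict
      \<open>far_imp_notin_Bset\<close>, so some distance above \<open>x\<close> reaches
      \<open>x - gam Q1\<close>.\<close>
    obtain Q3 where Q3: "Q3 \<in> Qs" "gam Q2 \<le> gam Q3" "nmul l (x - gam Q1) \<le> nmul l (gam Q3 - x)"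
    proof (cases "l = 0")
      case True
      then show ?thesis using that[of Q2] Q2(1) by simp
    next
      case False
      then have "\<not> (\<forall>Q\<in>Qs. gam Q - x < x - gam Q1)"
        using far_imp_notin_Bset[of l Q1] l Q1 by auto
      then obtain Q where Q: "Q \<in> Qs" "x - gam Q1 \<le> gam Q - x" by (auto simp: not_less)
      obtain Q3 where Q3: "Q3 \<in> Qs" "gam Q2 \<le> gam Q3" "gam Q \<le> gam Q3" using upper Q2(1) Q(1) by blast
      have "x - gam Q1 \<le> gam Q3 - x" using Q(2) Q3(3) by (meson diff_right_mono order.trans)
      then show ?thesis using that[OF Q3(1,2)] nmul_mono by blast
    qed
    have x3: "x \<le> gam Q3" using Q0 Q2(2) Q3(2) by simp
    then obtain Q4 where Q4: "Q4 \<in> Qs" "nmul (d + l) (gam Q3 - x) \<le> gam Q4 - x"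
      using unbounded[OF Q3(1)] by blast
    have "0 \<le> nmul (d + l) (gam Q3 - x)" using x3 by (intro nmul_nonneg) simp
    then have x4: "0 \<le> gam Q4 - x" using Q4(2) by (rule order.trans)
    have "b' \<le> \<beta> + nmul d (gam Q2) - nmul l (gam Q1)" using Q2(3) by (simp add: algebra_simps)
    also have "\<dots> = \<beta> + nmul (d - l) x + (nmul d (gam Q2 - x) + nmul l (x - gam Q1))"
      using l(2) by (simp add: nmul_diff_right nmul_diff_left algebra_simps)
    also have "\<dots> \<le> \<beta> + nmul (d - l) x + (nmul d (gam Q3 - x) + nmul l (gam Q3 - x))"
      by (rule add_left_mono[OF add_mono[OF nmul_mono[OF diff_right_mono[OF Q3(2)]] Q3(3)]])
    also have "\<dots> = \<beta> + nmul (d - l) x + nmul (d + l) (gam Q3 - x)" by (simp add: nmul_add_left)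
    also have "\<dots> \<le> \<beta> + nmul (d - l) x + (gam Q4 - x)" using Q4(2) by (rule add_left_mono)
    also have "\<dots> \<le> \<beta> + nmul (d - l) x + nmul (d - l) (gam Q4 - x)"
      using nmul_mono_left[of 1 "d - l" "gam Q4 - x"] x4 l(2) by (intro add_left_mono) simp
    also have "\<dots> = \<beta> + nmul (d - l) (gam Q4)" by (simp add: nmul_diff_right)
    finally have b4: "b' \<le> \<beta> + nmul (d - l) (gam Q4)" .
    show ?thesis
    proof (rule ev_largeI[OF Q4(1)])
      fix Q assume Q: "Q \<in> Qs" "gam Q0 \<le> gam Q" "gam Q4 \<le> gam Q"
      have "b \<le> \<beta> + nmul (d - l) (gam Q4)" using b' b4 by simp
      also have "\<dots> \<le> \<beta> + nmul (d - l) (gam Q)" using nmul_mono[OF Q(3)] by simp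
      finally have "Fin b \<le> Fin (\<beta> + nmul (d - l) (gam Q))" by simp
      also have "\<dots> \<le> betaQ \<nu> F Q l" using Q l by (intro betaQ_ge) auto
      finally show "Fin b \<le> betaQ \<nu> F Q l" .
    qed
  qed
  then show ?thesis using l by (simp add: Bunb_def)
qed

lemma d_eq_Min:
  "d \<in> Bset \<nu> Qs m F - Bunb \<nu> Qs m F" "d = Min (Bset \<nu> Qs m F - Bunb \<nu> Qs m F)"
  "d \<in> Bct \<nu> Qs m F" "d = Min (Bct \<nu> Qs m F)"
proof -
  have fin: "finite (Bset \<nu> Qs m F)" by (simp add: Bset_def)
  have sub: "Bct \<nu> Qs m F \<subseteq> Bset \<nu> Qs m F" by (auto simp: Bct_def)
  show 1: "d \<in> Bct \<nu> Qs m F" by (rule d_in_Bct)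
  then show 2: "d \<in> Bset \<nu> Qs m F - Bunb \<nu> Qs m F" using sub d_notin_Bunb by blast
  show "d = Min (Bct \<nu> Qs m F)"
    using 1 finite_subset[OF sub fin] notin_Bct by (intro Min_eqI[symmetric]) (auto simp: not_less[symmetric])
  show "d = Min (Bset \<nu> Qs m F - Bunb \<nu> Qs m F)"
    using 2 fin in_Bunb by (intro Min_eqI[symmetric]) (auto simp: not_less[symmetric])
qed

end

section \<open>Reduction to the situation of \<open>limit_data\<close>\<close>

theorem mainTheorem11:
  fixes \<nu> :: "'k::field poly \<Rightarrow> 'g::linordered_ab_group_add extended"
    and m :: nat and Qs :: "'k poly set" and F :: "'k poly" and d :: nat
  assumes divisible: "divisible_group TYPE('g)"
    and val: "poly_valuation \<nu>"
    and ws: "well_specified \<nu>"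
    and m_pos: "1 \<le> m"
    and Psi_ne: "Psi \<nu> m \<noteq> {}"
    and Psi_nomax: "\<not> (\<exists>P\<in>Psi \<nu> m. \<forall>P'\<in>Psi \<nu> m. \<nu> P' \<le> \<nu> P)"
    and Qs_sub: "Qs \<subseteq> Psi \<nu> m"
    and Qs_inj: "inj_on \<nu> Qs"
    and Qs_wo: "\<forall>S. S \<subseteq> Qs \<and> S \<noteq> {} \<longrightarrow> (\<exists>Q\<in>S. \<forall>R\<in>S. \<nu> Q \<le> \<nu> R)"
    and Qs_cofinal: "\<forall>P\<in>Psi \<nu> m. \<exists>Q\<in>Qs. \<nu> P \<le> \<nu> Q"
    and unstable_ex: "\<exists>f. \<not> Qstable \<nu> Qs f"
    and F_lim: "F \<in> KPinf \<nu> Qs"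
    and vunb: "\<not> vert_bounded (gammaL \<nu> Qs)"
    and defect: "ev_large Qs \<nu> (\<lambda>Q. degQ \<nu> Q F = d)"
  shows "Bset \<nu> Qs m F - Bunb \<nu> Qs m F \<noteq> {} \<and> d = Min (Bset \<nu> Qs m F - Bunb \<nu> Qs m F)
       \<and> Bct \<nu> Qs m F \<noteq> {} \<and> d = Min (Bct \<nu> Qs m F)"
proof -
  interpret key_val \<nu> m
    by unfold_locales (use val divisible m_pos Psi_nomax in auto)
  have Psi: "Q \<in> Psi \<nu> m" if "Q \<in> Qs" for Q using that Qs_sub by blast
  have nu_Q: "\<nu> Q = Fin (gam Q)" if "Q \<in> Qs" for Q using nu_gam[OF Psi[OF that]] .
  have nomax: "\<exists>Q'\<in>Qs. gam Q < gam Q'" if Q: "Q \<in> Qs" for Q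
  proof -
    obtain P where P: "P \<in> Psi \<nu> m" "\<nu> Q < \<nu> P" using Psi_nomax Psi[OF Q] by (meson not_le)
    then obtain Q' where Q': "Q' \<in> Qs" "\<nu> P \<le> \<nu> Q'" using Qs_cofinal by blast
    have "\<nu> Q < \<nu> Q'" using P Q' by simp
    then show ?thesis using Q Q'(1) nu_Q by auto
  qed
  have F: "lead_coeff F = 1" "\<not> Qstable \<nu> Qs F"
    and F_min: "\<And>g. lead_coeff g = 1 \<Longrightarrow> degree g < degree F \<Longrightarrow> Qstable \<nu> Qs g"
    using F_lim by (auto simp: KPinf_def not_less[symmetric])
  have F0: "F \<noteq> 0" using F(1) by auto
  obtain x where x: "x \<in> gammaL \<nu> Qs" and dbl: "\<And>n y. y \<in> gammaL \<nu> Qs \<Longrightarrow> x \<le> y \<Longrightarrow>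
      \<exists>z\<in>gammaL \<nu> Qs. x \<le> z \<and> nmul n (y - x) \<le> z - x"
    using not_vert_boundedE[OF divisible vunb] by metis
  obtain Qx where Qx: "Qx \<in> Qs" "x \<le> gam Qx" using x nu_Q by (auto simp: gammaL_def)
  obtain Qd where Qd: "Qd \<in> Qs" "\<And>Q. Q \<in> Qs \<Longrightarrow> gam Qd \<le> gam Q \<Longrightarrow> degQ \<nu> Q F = d"
    using defect nu_Q by (auto simp: ev_large_def)
  \<comment> \<open>The later of the two: it lies above \<open>x\<close> and in the range where
    \<open>degQ\<close> equals \<open>d\<close>.\<close>
  define Q0 where "Q0 = (if gam Qx \<le> gam Qd then Qd else Qx)"
  have Q0: "Q0 \<in> Qs" "x \<le> gam Q0" "gam Qd \<le> gam Q0" using Qx Qd by (auto simp: Q0_def)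
  have dQ: "degQ \<nu> Q F = d" if "Q \<in> Qs" "gam Q0 \<le> gam Q" for Q
    using Qd(2)[OF that(1)] Q0(3) that(2) by simp
  obtain \<beta> where \<beta>: "d \<le> degree F" "\<nu> (qcoeff Q0 F d) = Fin \<beta>"
    using degQ_coeffE[OF Psi[OF Q0(1)] F0] dQ[OF Q0(1)] by auto
  have beta: "\<nu> (qcoeff Q F d) = Fin \<beta>" if "Q \<in> Qs" "gam Q0 \<le> gam Q" for Q
    using top_coeff_constant[OF Psi[OF Q0(1)] Psi[OF that(1)] that(2) F0] dQ[OF Q0(1)] \<beta>(2) by simp
  have nuQ_F: "nuQ \<nu> Q F = Fin (\<beta> + nmul d (gam Q))" if "Q \<in> Qs" "gam Q0 \<le> gam Q" for Q
    using degQ_coeffE[OF Psi[OF that(1)] F0] dQ[OF that] beta[OF that]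
    by (metis extended.inject)
  have d_pos: "1 \<le> d"
  proof (rule ccontr)
    assume "\<not> 1 \<le> d"
    then have "nuQ \<nu> Q F = \<nu> F" if "Q \<in> Qs" "gam Q0 \<le> gam Q" for Q
      using nuQ_eq_nu_if_degQ_0[OF Psi[OF that(1)] F0] dQ[OF that] by simp
    then have "Qstable \<nu> Qs F" unfolding Qstable_def ev_large_def using Q0(1) nu_Q by auto
    then show False using F(2) by simp
  qed
  \<comment> \<open>A nonzero coefficient at index \<open>d\<close> forces
    \<open>d * m \<le> degree F\<close>, which yields both degree conditions of the locale.\<close>
  have "qcoeff Q0 F d \<noteq> 0" using \<beta>(2) by auto
  then have "\<not> degree F < d * degree Q0" using qcoeff_eq_0 by blast
  then have dm: "d * m \<le> degree F" using Psi_degree[OF Psi[OF Q0(1)]] by simp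
  have d_le: "d \<le> Dnum F m"
    unfolding Dnum_def using dm m_pos by (simp add: less_eq_div_iff_mult_less_eq)
  have m_le: "m \<le> degree F" using dm d_pos by (metis mult_le_mono1 nat_mult_1 order.trans)
  \<comment> \<open>\<open>dbl\<close> speaks of the cut; its elements are bounded by values of
    members of \<open>Qs\<close>.\<close>
  have unb: "\<exists>Q'\<in>Qs. nmul n (gam Q - x) \<le> gam Q' - x" if Q: "Q \<in> Qs" "x \<le> gam Q" for Q n
  proof -
    have "gam Q \<in> gammaL \<nu> Qs"
      using Q nu_Q gam_in_Gam[OF Psi[OF Q(1)]] by (auto simp: gammaL_def)
    then obtain z where z: "z \<in> gammaL \<nu> Qs" "nmul n (gam Q - x) \<le> z - x" using dbl Q(2) by blast
    then obtain Q' where Q': "Q' \<in> Qs" "z \<le> gam Q'" using nu_Q by (auto simp: gammaL_def)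
    then have "nmul n (gam Q - x) \<le> gam Q' - x" using z(2) by (meson diff_right_mono order.trans)
    then show ?thesis using Q' by blast
  qed
  interpret limit_data \<nu> m Qs F d \<beta> x Q0
    by unfold_locales (fact Qs_sub nomax F_min m_le Q0(1) Q0(2) unb beta nuQ_F d_pos d_le)+
  show ?thesis using d_eq_Min by blast
qed

end
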